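(* Let $R=K[[\mathbf x,y,z]]$ with $\mathbf x=(x_1,\dots,x_n)$ and let $J\subseteq R$ be an ideal of order $c=\mathrm{ord}\,J$. Suppose $J_{-1}=\mathrm{coeff}^c_{(\mathbf x,y,z)}(J)$ has a factorization $J_{-1}=(\mathbf x^ry^{r_y})\cdot I_{-1}$ with $r=(r_1,\dots,r_n)\in\mathbb N^n$, $r_y\in\mathbb N$ and $I_{-1}\subseteq K[[\mathbf x,y]]$ an ideal of order $d$, and set $J_{-2}=\mathrm{coeff}^d_{(\mathbf x,y)}(I_{-1})$. Let $z=\tilde z+g$ with $g\in K[[\mathbf x,y]]$, $\mathrm{ord}\,g\ge1$, be a coordinate change that preserves the setting, i.e. $\tilde J_{-1}=\mathrm{coeff}^c_{(\mathbf x,y,\tilde z)}(J)$ has a factorization $\tilde J_{-1}=(\mathbf x^ry^{r_y})\cdot\tilde I_{-1}$ with $\mathrm{ord}\,\tilde I_{-1}=d$, and set $\tilde J_{-2}=\mathrm{coeff}^d_{(\mathbf x,y)}(\tilde I_{-1})$. If there is an element $f\in J$ that is secondary $\mathrm{ord}$-clean with respect to $J_{-2}$, then $\mathrm{ord}\,\tilde J_{-2}\le\mathrm{ord}\,J_{-2}$.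
   Context: $K$ is an algebraically closed field of arbitrary characteristic and $c$ is a positive integer. In a power series ring $\mathrm{ord}\,J=\sup\{n:J\subseteq\mathfrak m^n\}$, $\mathfrak m$ the maximal ideal (so $\mathrm{ord}\,0=\infty$). For $f\ne0$, $\mathrm{in}(f)$ denotes the homogeneous part of lowest degree of the power series $f$ in the given parameters; $\mathrm{in}(0)=0$. Coefficient ideal: for an ideal $J$ of $K[[\mathbf u,w]]$ and each $f\in J$ written as $f=\sum_{i\ge0}f_iw^i$ with $f_i\in K[[\mathbf u]]$, $\mathrm{coeff}^c_{(\mathbf u,w)}(J)=(f_i^{c!/(c-i)}:f\in J,\ 0\le i<c)\subseteq K[[\mathbf u]]$; $\mathrm{coeff}^0_{(\mathbf u,w)}(J)=0$. $f\in R$ is $z$-regular of order $c$ if $f(0,\dots,0,z)=z^cu(z)$ with $u\in K[[z]]^*$. Put $q=1$ if $\mathrm{char}K=0$ and $q=p^{\mathrm{ord}_pc}$ (the largest power of $p$ dividing $c$) if $\mathrm{char}K=p>0$. Set $s=\mathrm{ord}\,J_{-2}$, $|r|=\sum r_i$ and $\delta=\frac1{c!}\big((d+r_y)\frac s{d!}+|r|\big)$. Write $f=\sum_{i,j\ge0}f_{i,j}y^jz^i$ with $f_{i,j}\in K[[\mathbf x]]$. An element $f\in J$ which is $z$-regular of order $c$ is secondary $\mathrm{ord}$-clean with respect to $J_{-2}$ if for every index $b\in\mathbb N$ with $b<\frac{d+r_y}{c!}$ at least one of the following holds: (i) there are indices $i,j$ with $c-q<i<c$, $j\le(c-i)b$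 and $\mathrm{ord}\,f_{i,j}=(c-i)\delta-j\frac s{d!}$; (ii) $\mathrm{ord}\,f_{c-q,bq}>q\delta-bq\frac s{d!}$; (iii) there is no $G\in K[[\mathbf x]]$ with $\mathrm{in}(f_{c-q,bq})=\mathrm{in}(f_{c,0})\cdot G^q$. *)

theory Defs
  imports
    "HOL-Computational_Algebra.Computational_Algebra"
    "HOL-Library.Numeral_Type"
    "HOL-Library.Groups_Big_Fun"
    "HOL-Library.Extended_Real"
begin

section \<open>Power series in \<open>n\<close> variables\<close>

text \<open>
  The type \<open>'n expo\<close> is the monoid of exponent vectors \<open>\<nat>\<^sup>n\<close> with \<open>n = CARD('n)\<close>. As usual
  \<^prop>\<open>CARD('n) = 0\<close> for an infinite type (for instance the numeral type \<open>0\<close>), so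
  all \<open>n \<ge> 0\<close> are covered, without any restriction on \<open>'n\<close>.
\<close>

typedef 'n expo = "{e :: nat \<Rightarrow> nat. \<forall>i\<ge>CARD('n). e i = 0}"
  morphisms expo_nth Abs_expo
  by (rule exI[of _ "\<lambda>_. 0"]) simp

setup_lifting type_definition_expo

instantiation expo :: (type) cancel_comm_monoid_add
begin

lift_definition zero_expo :: "'a expo" is "\<lambda>_. 0" by simp
lift_definition plus_expo :: "'a expo \<Rightarrow> 'a expo \<Rightarrow> 'a expo" is "\<lambda>d e i. d i + e i" by simp
lift_definition minus_expo :: "'a expo \<Rightarrow> 'a expo \<Rightarrow> 'a expo" is "\<lambda>d e i. d i - e i" by simp

instance
  by (standard; transfer; auto simp: fun_eq_iff)

end

definition expo_deg :: "'n expo \<Rightarrow> nat" where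
  "expo_deg e = (\<Sum>i<CARD('n). expo_nth e i)"

lemma finite_expo_antidiagonal: "finite {(d, d'). d + d' = (e :: 'n expo)}"
proof -
  let ?F = "{h :: nat \<Rightarrow> nat. \<forall>i. (i \<in> {..<CARD('n)} \<longrightarrow> h i \<in> {..\<Sum>i<CARD('n). expo_nth e i}) \<and>
                 (i \<notin> {..<CARD('n)} \<longrightarrow> h i = 0)}"
  have fin: "finite ?F"
    by (rule finite_set_of_finite_funs) auto
  have nth: "expo_nth d i \<le> (\<Sum>i<CARD('n). expo_nth e i)"
    if "d + d' = e" "i < CARD('n)" for d d' i
  proof -
    have "expo_nth d i \<le> expo_nth e i"
      unfolding that(1)[symmetric] by transfer simp
    also have "\<dots> \<le> (\<Sum>i<CARD('n). expo_nth e i)"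
      using that(2) by (intro member_le_sum) auto
    finally show ?thesis .
  qed
  have nth': "expo_nth d' i \<le> (\<Sum>i<CARD('n). expo_nth (d + d') i)"
    if "d + d' = e" "i < CARD('n)" for d d' i
    using nth[of d' d i] that by (simp add: add.commute)
  have out: "expo_nth (d :: 'n expo) i = 0" if "\<not> i < CARD('n)" for d i
    using that expo_nth[of d] by auto
  let ?D = "expo_nth -` ?F :: 'n expo set"
  have "finite ?D"
    by (rule finite_vimageI[OF fin]) (auto simp: inj_on_def expo_nth_inject)
  moreover have "{(d, d'). d + d' = e} \<subseteq> ?D \<times> ?D"
    using nth out by (auto intro: nth')
  ultimately show ?thesis
    using finite_subset by blast
qed

text \<open>\<open>('n, 'k) mps\<close> is the power series ring \<open>K[[x\<^sub>1,\<dots>,x\<^sub>n]]\<close> over \<open>K = 'k\<close>.\<close>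

typedef ('n, 'k) mps = "UNIV :: ('n expo \<Rightarrow> 'k) set"
  morphisms mps_nth Abs_mps
  by simp

setup_lifting type_definition_mps

lemma mps_eq_iff: "f = g \<longleftrightarrow> (\<forall>e. mps_nth f e = mps_nth g e)"
  by transfer auto

definition mps_monom :: "'n expo \<Rightarrow> ('n, 'k :: zero_neq_one) mps" where
  "mps_monom r = Abs_mps (\<lambda>e. if e = r then 1 else 0)"

instantiation mps :: (type, comm_ring_1) comm_ring_1
begin

lift_definition zero_mps :: "('a, 'b) mps" is "\<lambda>_. 0" .
lift_definition one_mps :: "('a, 'b) mps" is "\<lambda>e. if e = 0 then 1 else 0" .
lift_definition plus_mps :: "('a, 'b) mps \<Rightarrow> ('a, 'b) mps \<Rightarrow> ('a, 'b) mps" is "\<lambda>f g e. f e + g e" .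
lift_definition minus_mps :: "('a, 'b) mps \<Rightarrow> ('a, 'b) mps \<Rightarrow> ('a, 'b) mps" is "\<lambda>f g e. f e - g e" .
lift_definition uminus_mps :: "('a, 'b) mps \<Rightarrow> ('a, 'b) mps" is "\<lambda>f e. - f e" .
lift_definition times_mps :: "('a, 'b) mps \<Rightarrow> ('a, 'b) mps \<Rightarrow> ('a, 'b) mps" is
  "\<lambda>f g e. \<Sum>(d, d') \<in> {(d, d'). d + d' = e}. f d * g d'" .

instance
proof
  fix f g h :: "('a, 'b) mps"
  show "f + g + h = f + (g + h)" "f + g = g + f" "0 + f = f" "- f + f = 0" "f - g = f + - g"
    by (transfer; simp add: fun_eq_iff algebra_simps)+
  show "f * g = g * f"
  proof (transfer, rule ext)
    fix f g :: "'a expo \<Rightarrow> 'b" and e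
    show "(\<Sum>(d, d')\<in>{(d, d'). d + d' = e}. f d * g d') =
          (\<Sum>(d, d')\<in>{(d, d'). d + d' = e}. g d * f d')"
      by (rule sum.reindex_bij_witness[of _ prod.swap prod.swap])
         (auto simp: add.commute mult.commute)
  qed
  show "f * g * h = f * (g * h)"
  proof (transfer, rule ext)
    fix f g h :: "'a expo \<Rightarrow> 'b" and e
    let ?A = "\<lambda>e. {(d, d'). d + d' = (e :: 'a expo)}"
    have "(\<Sum>(d, d')\<in>?A e. (\<Sum>(a, b)\<in>?A d. f a * g b) * h d') =
          (\<Sum>x\<in>?A e. \<Sum>y\<in>?A (fst x). f (fst y) * g (snd y) * h (snd x))"
      by (simp add: case_prod_unfold sum_distrib_right)
    also have "\<dots> = (\<Sum>(x, y)\<in>Sigma (?A e) (\<lambda>x. ?A (fst x)). f (fst y) * g (snd y) * h (snd x))"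
      by (rule sum.Sigma) (auto simp: finite_expo_antidiagonal)
    also have "\<dots> = (\<Sum>(x, y)\<in>Sigma (?A e) (\<lambda>x. ?A (snd x)). f (fst x) * (g (fst y) * h (snd y)))"
      by (rule sum.reindex_bij_witness
          [of _ "\<lambda>(x, y). ((fst x + fst y, snd y), (fst x, fst y))"
                "\<lambda>(x, y). ((fst y, snd y + snd x), (snd y, snd x))"])
         (auto simp: algebra_simps)
    also have "\<dots> = (\<Sum>x\<in>?A e. \<Sum>y\<in>?A (snd x). f (fst x) * (g (fst y) * h (snd y)))"
      by (rule sum.Sigma[symmetric]) (auto simp: finite_expo_antidiagonal)
    also have "\<dots> = (\<Sum>(d, d')\<in>?A e. f d * (\<Sum>(a, b)\<in>?A d'. g a * h b))"
      by (simp add: case_prod_unfold sum_distrib_left)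
    finally show "(\<Sum>(d, d')\<in>?A e. (\<Sum>(a, b)\<in>?A d. f a * g b) * h d') =
                  (\<Sum>(d, d')\<in>?A e. f d * (\<Sum>(a, b)\<in>?A d'. g a * h b))" .
  qed
  show "1 * f = f"
  proof (transfer, rule ext)
    fix f :: "'a expo \<Rightarrow> 'b" and e
    have "(\<Sum>x\<in>{(d, d'). d + d' = e}. (if fst x = 0 then 1 else 0) * f (snd x)) =
          (\<Sum>x\<in>{(0 :: 'a expo, e)}. (if fst x = 0 then 1 else 0) * f (snd x))"
      by (rule sum.mono_neutral_right[OF finite_expo_antidiagonal]) auto
    then show "(\<Sum>(d, d')\<in>{(d, d'). d + d' = e}. (if d = 0 then 1 else 0) * f d') = f e"
      by (simp add: case_prod_unfold)
  qed
  show "(f + g) * h = f * h + g * h"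
    by transfer (simp add: fun_eq_iff case_prod_unfold distrib_right sum.distrib)
  show "(0 :: ('a, 'b) mps) \<noteq> 1"
    by transfer (metis zero_neq_one)
qed

end

text \<open>The homogeneous part of lowest degree; it is \<open>0\<close> for \<open>f = 0\<close>.\<close>

definition mps_in :: "('n, 'k :: comm_ring_1) mps \<Rightarrow> ('n, 'k) mps" where
  "mps_in f = Abs_mps (\<lambda>e. if expo_deg e = (LEAST m. \<exists>e'. expo_deg e' = m \<and> mps_nth f e' \<noteq> 0)
                           then mps_nth f e else 0)"


section \<open>Ideals, orders and coefficient ideals\<close>

definition is_ideal :: "'a :: comm_ring_1 set \<Rightarrow> bool" where
  "is_ideal = module.subspace (*)"

definition gen_ideal :: "'a :: comm_ring_1 set \<Rightarrow> 'a set" where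
  "gen_ideal = module.span (*)"

lemma module_mult: "module ((*) :: 'a :: comm_ring_1 \<Rightarrow> 'a \<Rightarrow> 'a)"
  by standard (simp_all add: algebra_simps)

text \<open>The set of non-units, which is the maximal ideal as soon as the ring is local.\<close>

definition max_ideal :: "'a :: comm_ring_1 set" where
  "max_ideal = {a. \<not> a dvd 1}"

fun ideal_pow :: "'a :: comm_ring_1 set \<Rightarrow> nat \<Rightarrow> 'a set" where
  "ideal_pow I 0 = UNIV"
| "ideal_pow I (Suc m) = gen_ideal {a * b | a b. a \<in> I \<and> b \<in> ideal_pow I m}"

definition ideal_ord :: "'a :: comm_ring_1 set \<Rightarrow> enat" where
  "ideal_ord J = Sup {enat m | m. J \<subseteq> ideal_pow max_ideal m}"

definition elem_ord :: "'a :: comm_ring_1 \<Rightarrow> enat" where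
  "elem_ord f = ideal_ord {f}"

text \<open>
  For an ideal \<open>J\<close> of \<open>A[[w]]\<close>, where \<open>A = 'a\<close> is \<open>K[[\<^bold>u]]\<close>. The division of naturals is exact.
  For \<open>c = 0\<close> there are no generators, so that the result is the zero ideal.
\<close>

definition coeff_ideal :: "nat \<Rightarrow> 'a :: comm_ring_1 fps set \<Rightarrow> 'a set" where
  "coeff_ideal c J = gen_ideal {fps_nth f i ^ (fact c div (c - i)) | f i. f \<in> J \<and> i < c}"


section \<open>The rings \<open>K[[\<^bold>x,y]]\<close> and \<open>K[[\<^bold>x,y,z]]\<close>\<close>

text \<open>
  \<open>K[[\<^bold>x,y]]\<close> is \<open>('n, 'k) mps fps\<close>, a power series ring in \<open>y\<close> over \<open>K[[\<^bold>x]]\<close>, and \<open>K[[\<^bold>x,y,z]]\<close> is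
  \<open>('n, 'k) mps fps fps\<close>, a power series ring in \<open>z\<close> over \<open>K[[\<^bold>x,y]]\<close>. So
  \<open>fps_nth (fps_nth f i) j\<close> is the coefficient \<open>f\<^sub>i\<^sub>,\<^sub>j\<close> of \<open>y\<^sup>jz\<^sup>i\<close> in \<open>f\<close>.
\<close>

definition xy_monom :: "'n expo \<Rightarrow> nat \<Rightarrow> ('n, 'k :: comm_ring_1) mps fps" where
  "xy_monom r r_y = fps_const (mps_monom r) * fps_X ^ r_y"

definition z_regular :: "nat \<Rightarrow> ('n, 'k :: comm_ring_1) mps fps fps \<Rightarrow> bool" where
  "z_regular c f \<longleftrightarrow>
     (\<exists>u :: 'k fps. u dvd 1 \<and>
        Abs_fps (\<lambda>i. mps_nth (fps_nth (fps_nth f i) 0) 0) = fps_X ^ c * u)"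

text \<open>
  \<open>z_shift g f\<close> is \<open>f(\<^bold>x, y, z + g)\<close>, i.e. the expansion in \<open>(\<^bold>x, y, z')\<close> of \<open>f \<in> K[[\<^bold>x,y,z]]\<close> where
  \<open>z = z' + g\<close>: the coefficient of \<open>z'\<^sup>i\<close> is \<open>\<Sum>k\<ge>i. (k choose i) f\<^sub>k g\<^sup>k\<^sup>-\<^sup>i\<close>. If \<open>g\<close> has order at
  least \<open>1\<close>, then only finitely many \<open>k\<close> contribute to a given monomial in \<open>\<^bold>x\<close> and \<open>y\<close>.
\<close>

definition z_shift ::
  "('n, 'k :: comm_ring_1) mps fps \<Rightarrow> ('n, 'k) mps fps fps \<Rightarrow> ('n, 'k) mps fps fps" where
  "z_shift g f = Abs_fps (\<lambda>i. Abs_fps (\<lambda>j. Abs_mps (\<lambda>e.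
     Sum_any (\<lambda>k. mps_nth (fps_nth (of_nat (k choose i) * fps_nth f k * g ^ (k - i)) j) e))))"


section \<open>Secondary cleanness\<close>

definition char_part :: "'k :: semiring_1 itself \<Rightarrow> nat \<Rightarrow> nat" where
  "char_part _ c = (if CHAR('k) = 0 then 1 else CHAR('k) ^ multiplicity CHAR('k) c)"

text \<open>
  The arguments \<open>c\<close>, \<open>d\<close>, \<open>r\<close>, \<open>r_y\<close> are the data of the setting and \<open>J2\<close> is the ideal \<open>J\<^sub>-\<^sub>2\<close>.
  The order of \<open>J2\<close> may be infinite, hence the use of extended reals.
\<close>

definition secondary_ord_clean ::
  "nat \<Rightarrow> nat \<Rightarrow> 'n expo \<Rightarrow> nat \<Rightarrow> ('n, 'k :: field) mps set \<Rightarrow> ('n, 'k) mps fps fps \<Rightarrow> bool" where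
  "secondary_ord_clean c d r r_y J2 f \<longleftrightarrow> z_regular c f \<and>
     (let q = char_part TYPE('k) c;
          \<sigma> = ereal_of_enat (ideal_ord J2) / ereal (fact d);
          \<delta> = (ereal (real (d + r_y)) * \<sigma> + ereal (real (expo_deg r))) / ereal (fact c);
          F = (\<lambda>i j. fps_nth (fps_nth f i) j)
      in \<forall>b :: nat. real b < real (d + r_y) / fact c \<longrightarrow>
           (\<exists>i j. c - q < i \<and> i < c \<and> j \<le> (c - i) * b \<and>
              ereal_of_enat (elem_ord (F i j)) = ereal (real (c - i)) * \<delta> - ereal (real j) * \<sigma>) \<or>
           ereal_of_enat (elem_ord (F (c - q) (b * q))) >
             ereal (real q) * \<delta> - ereal (real (b * q)) * \<sigma> \<or>
           \<not> (\<exists>G. mps_in (F (c - q) (b * q)) = mps_in (F c 0) * G ^ q))"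

end

theory Submission
  imports Defs "HOL-Library.Product_Lexorder" "HOL-Library.Product_Plus"
begin

text \<open>
  Put \<open>\<sigma> = s/d!\<close> and give \<open>x\<^sub>1,\<dots>,x\<^sub>n\<close> weight \<open>1\<close> and \<open>y\<close> weight \<open>\<sigma>\<close>. By definition of the coefficient
  ideal, \<open>ord J\<^sub>-\<^sub>2 \<ge> s\<close> says that \<open>I\<^sub>-\<^sub>1\<close> has weighted order at least \<open>d\<sigma>\<close>. Hence \<open>J\<^sub>-\<^sub>1\<close> has weighted
  order at least \<open>c!\<delta>\<close>, that is, the coefficient \<open>f\<^sub>i\<close> of \<open>z\<^sup>i\<close> in any \<open>f \<in> J\<close> has weighted order at
  least \<open>(c-i)\<delta>\<close> for all \<open>i < c\<close>. Suppose the order of the second coefficient ideal did increase to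
  more than \<open>s\<close>. Then the same estimates hold for the coefficients \<open>f'\<^sub>i\<close> after the change \<open>z = z' + g\<close>,
  but for a slightly larger weight \<open>\<sigma>'\<close> of \<open>y\<close>, with \<open>\<delta>'\<close> in place of \<open>\<delta>\<close>. The two families of
  coefficients are related by \<open>f'\<^sub>i = \<Sum>\<^sub>k (k choose i) f\<^sub>k g\<^sup>k\<^sup>-\<^sup>i\<close>.

  If \<open>g\<close> has \<open>\<sigma>'\<close>-weighted order at least \<open>\<delta>'\<close>, these relations carry the estimates back to the
  \<open>f\<^sub>i\<close> (\<open>z_shift_val_ideal_back\<close>), so that \<open>\<sigma>'\<close> would already be available for \<open>J\<^sub>-\<^sub>2\<close>, whose order is
  \<open>s\<close>.

  Otherwise let \<open>m < \<delta>'\<close> be the \<open>\<sigma>'\<close>-weighted order of \<open>g\<close>. Since the \<open>f'\<^sub>i\<close> have order greater than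
  \<open>(c-i)m\<close>, their parts in that order vanish, and solving the relations shows that \<open>f\<^sub>i\<close> agrees with
  \<open>(c choose i) f\<^sub>c (-g)\<^sup>c\<^sup>-\<^sup>i\<close> up to terms of order greater than \<open>(c-i)m\<close>
  (\<open>z_shift_initial_form\<close>): in lowest order \<open>f\<close> is the pure power \<open>f\<^sub>c (z-g)\<^sup>c\<close>. As \<open>f\<^sub>c\<close> is a unit,
  \<open>f\<^sub>0\<close> has order exactly \<open>cm\<close>. Comparing this with the estimate for the weight \<open>\<sigma>\<close> shows that, for
  \<open>\<sigma>'\<close> close enough to \<open>\<sigma>\<close>, the initial form of \<open>g\<close> is \<open>y\<^sup>b\<close> times a form in \<open>\<^bold>x\<close> of degree
  \<open>\<delta> - b\<sigma>\<close>, with \<open>b < (d + r\<^sub>y)/c!\<close>. For this \<open>b\<close> all three alternatives of cleanness fail: the binomial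
  coefficients \<open>c choose i\<close> with \<open>c-q < i < c\<close> vanish in \<open>K\<close> while \<open>c choose q\<close> does not
  (\<open>char_part_choose\<close>), so the lowest form of \<open>f\<^sub>c\<^sub>-\<^sub>q\<^sub>,\<^sub>b\<^sub>q\<close> is a nonzero constant times a \<open>q\<close>-th power,
  and the constant has a \<open>q\<close>-th root (\<open>not_secondary_ord_clean\<close>).

  All weights are multiplied by a common denominator so that they are natural numbers. The
  comparison is exact for \<open>\<sigma>' = \<sigma> + 1/(N\<cdot>d!)\<close> with \<open>N = d + r\<^sub>y\<close>.
\<close>


section \<open>Exponent vectors and their lexicographic order\<close>

lemma expo_eqI: "(\<And>i. expo_nth e i = expo_nth e' i) \<Longrightarrow> e = e'"
  by (metis expo_nth_inject ext)

lemma expo_nth_zero [simp]: "expo_nth 0 i = 0"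
  by (simp add: zero_expo.rep_eq)

lemma expo_nth_add [simp]: "expo_nth (d + e) i = expo_nth d i + expo_nth e i"
  by (simp add: plus_expo.rep_eq)

lemma expo_nth_diff [simp]: "expo_nth (d - e) i = expo_nth d i - expo_nth e i"
  by (simp add: minus_expo.rep_eq)

lemma expo_nth_outside: "CARD('n) \<le> i \<Longrightarrow> expo_nth (e :: 'n expo) i = 0"
  using expo_nth[of e] by auto

lemma expo_deg_zero [simp]: "expo_deg 0 = 0"
  by (simp add: expo_deg_def)

lemma expo_deg_add [simp]: "expo_deg (d + e) = expo_deg d + expo_deg e"
  by (simp add: expo_deg_def sum.distrib)

lemma expo_deg_eq_0_iff [simp]: "expo_deg e = 0 \<longleftrightarrow> e = 0"
proof
  assume "expo_deg e = 0"
  then have "expo_nth e i = 0" if "i < CARD('a)" for i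
    using that by (simp add: expo_deg_def)
  then show "e = 0"
    using expo_nth_outside[of _ e] by (intro expo_eqI) (metis expo_nth_zero not_le)
qed simp

lemma finite_expo_deg_le: "finite {e :: 'n expo. expo_deg e \<le> m}"
proof -
  let ?F = "{h :: nat \<Rightarrow> nat. \<forall>i. (i \<in> {..<CARD('n)} \<longrightarrow> h i \<in> {..m}) \<and>
                 (i \<notin> {..<CARD('n)} \<longrightarrow> h i = 0)}"
  have "finite ?F"
    by (rule finite_set_of_finite_funs) auto
  then have "finite (expo_nth -` ?F :: 'n expo set)"
    by (rule finite_vimageI) (auto simp: inj_on_def expo_nth_inject)
  moreover have "{e :: 'n expo. expo_deg e \<le> m} \<subseteq> expo_nth -` ?F"
  proof clarsimp
    fix e :: "'n expo" and i
    assume "expo_deg e \<le> m"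
    moreover have "expo_nth e i \<le> expo_deg e" if "i < CARD('n)"
      unfolding expo_deg_def using that by (intro member_le_sum) auto
    ultimately show "(i < CARD('n) \<longrightarrow> expo_nth e i \<le> m) \<and> (\<not> i < CARD('n) \<longrightarrow> expo_nth e i = 0)"
      using expo_nth_outside[of i e] by auto
  qed
  ultimately show ?thesis
    by (rule rev_finite_subset)
qed

text \<open>
  An additive linear order on exponents singles out one monomial of an initial form; the
  coefficient of a power at the corresponding multiple is then a power of a single coefficient.
\<close>

instantiation expo :: (type) linorder
begin

definition less_eq_expo :: "'a expo \<Rightarrow> 'a expo \<Rightarrow> bool" where
  "less_eq d e \<longleftrightarrow> d = e \<or> (\<exists>i. expo_nth d i < expo_nth e i \<and> (\<forall>j<i. expo_nth d j = expo_nth e j))"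

definition less_expo :: "'a expo \<Rightarrow> 'a expo \<Rightarrow> bool" where
  "d < e \<longleftrightarrow> (\<exists>i. expo_nth d i < expo_nth e i \<and> (\<forall>j<i. expo_nth d j = expo_nth e j))"

instance
proof
  have irrefl: "\<not> x < x" for x :: "'a expo"
    by (auto simp: less_expo_def)
  have le: "x \<le> y \<longleftrightarrow> x = y \<or> x < y" for x y :: "'a expo"
    by (auto simp: less_expo_def less_eq_expo_def)
  have trans: "x < z" if "x < y" "y < z" for x y z :: "'a expo"
  proof -
    obtain i where i: "expo_nth x i < expo_nth y i" "\<forall>j<i. expo_nth x j = expo_nth y j"
      using \<open>x < y\<close> by (auto simp: less_expo_def)
    obtain k where k: "expo_nth y k < expo_nth z k" "\<forall>j<k. expo_nth y j = expo_nth z j"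
      using \<open>y < z\<close> by (auto simp: less_expo_def)
    have "expo_nth x (min i k) < expo_nth z (min i k)"
      using i k by (cases i k rule: linorder_cases) auto
    with i k show ?thesis
      unfolding less_expo_def by (intro exI[of _ "min i k"]) auto
  qed
  have total: "x < y \<or> x = y \<or> y < x" for x y :: "'a expo"
  proof (cases "x = y")
    case False
    then obtain i where "expo_nth x i \<noteq> expo_nth y i"
      using expo_eqI by blast
    define k where "k = (LEAST i. expo_nth x i \<noteq> expo_nth y i)"
    have "expo_nth x k \<noteq> expo_nth y k"
      unfolding k_def using \<open>expo_nth x i \<noteq> expo_nth y i\<close> by (rule LeastI)
    moreover have "\<forall>j<k. expo_nth x j = expo_nth y j"
      unfolding k_def using not_less_Least by blast
    ultimately show ?thesis
      unfolding less_expo_def by (metis linorder_neqE_nat)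
  qed simp
  fix x y z :: "'a expo"
  show "x < y \<longleftrightarrow> x \<le> y \<and> \<not> y \<le> x"
    using irrefl trans by (auto simp: le)
  show "x \<le> x"
    by (simp add: le)
  show "x \<le> y \<Longrightarrow> y \<le> z \<Longrightarrow> x \<le> z"
    using trans by (auto simp: le)
  show "x \<le> y \<Longrightarrow> y \<le> x \<Longrightarrow> x = y"
    using irrefl trans by (auto simp: le)
  show "x \<le> y \<or> y \<le> x"
    using total by (auto simp: le)
qed

end

instance expo :: (type) linordered_cancel_ab_semigroup_add
  by standard (auto simp: less_eq_expo_def less_expo_def)

type_synonym 'n xy_expo = "nat \<times> 'n expo"

lemma xy_expo_add_less:
  fixes \<mu> \<nu> \<alpha> \<beta> :: "'n xy_expo"
  assumes "\<alpha> < \<mu>" "\<beta> \<le> \<nu>"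
  shows "\<alpha> + \<beta> < \<mu> + \<nu>"
  using assms
  by (cases \<alpha>; cases \<beta>; cases \<mu>; cases \<nu>)
     (auto simp: intro: add_less_le_mono add_le_less_mono add_less_mono add_mono)

lemma xy_expo_add_mono:
  fixes \<mu> \<nu> \<alpha> \<beta> :: "'n xy_expo"
  assumes "\<alpha> \<le> \<mu>" "\<beta> \<le> \<nu>"
  shows "\<alpha> + \<beta> \<le> \<mu> + \<nu>"
  using assms
  by (cases \<alpha>; cases \<beta>; cases \<mu>; cases \<nu>)
     (auto simp: intro: add_less_le_mono add_le_less_mono add_less_mono add_mono)

lemma finite_xy_antidiagonal: "finite {(\<alpha>, \<beta>). \<alpha> + \<beta> = (\<mu> :: 'n xy_expo)}"
proof -
  let ?A = "{(d, d'). d + d' = snd \<mu>}" and ?S = "{..fst \<mu>} \<times> {..fst \<mu>}"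
  have "p \<in> (\<lambda>((i, j), d, d'). ((i, d), (j, d'))) ` (?S \<times> ?A)"
    if "p \<in> {(\<alpha>, \<beta>). \<alpha> + \<beta> = \<mu>}" for p
    using that by (intro image_eqI[of _ _ "((fst (fst p), fst (snd p)), (snd (fst p), snd (snd p)))"]) auto
  moreover have "finite (?S \<times> ?A)"
    by (intro finite_cartesian_product finite_expo_antidiagonal) auto
  ultimately show ?thesis
    using finite_surj by (metis (no_types, lifting) subsetI)
qed

section \<open>Coefficients of products\<close>

definition xy_coeff :: "('n, 'k :: comm_ring_1) mps fps \<Rightarrow> 'n xy_expo \<Rightarrow> 'k" where
  "xy_coeff a \<mu> = mps_nth (fps_nth a (fst \<mu>)) (snd \<mu>)"

lemma mps_nth_simps [simp]:
  "mps_nth 0 e = 0" "mps_nth (f + g) e = mps_nth f e + mps_nth g e"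
  "mps_nth (f - g) e = mps_nth f e - mps_nth g e" "mps_nth (- f) e = - mps_nth f e"
  "mps_nth (Abs_mps h) e = h e"
  by (simp_all add: zero_mps.rep_eq plus_mps.rep_eq minus_mps.rep_eq uminus_mps.rep_eq Abs_mps_inverse)

lemma mps_nth_one: "mps_nth 1 e = (if e = 0 then 1 else 0)"
  by (simp add: one_mps.rep_eq)

lemma mps_nth_times: "mps_nth (f * g) e = (\<Sum>(d, d') \<in> {(d, d'). d + d' = e}. mps_nth f d * mps_nth g d')"
  by (simp add: times_mps.rep_eq)

lemma mps_nth_sum: "mps_nth (sum f A) e = (\<Sum>a\<in>A. mps_nth (f a) e)"
  by (induction A rule: infinite_finite_induct) auto

lemma mps_nth_of_nat_mult [simp]: "mps_nth (of_nat m * f) e = of_nat m * mps_nth f e"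
  by (induction m) (auto simp: algebra_simps)

lemma xy_coeff_simps [simp]:
  "xy_coeff 0 \<mu> = 0" "xy_coeff (a + b) \<mu> = xy_coeff a \<mu> + xy_coeff b \<mu>" "xy_coeff (a - b) \<mu> = xy_coeff a \<mu> - xy_coeff b \<mu>"
  "xy_coeff (- a) \<mu> = - xy_coeff a \<mu>"
  by (simp_all add: xy_coeff_def)

lemma xy_coeff_one: "xy_coeff 1 \<mu> = (if \<mu> = 0 then 1 else 0)"
  by (cases \<mu>) (auto simp: xy_coeff_def mps_nth_one zero_prod_def)

lemma xy_coeff_sum: "xy_coeff (sum f A) \<mu> = (\<Sum>a\<in>A. xy_coeff (f a) \<mu>)"
  by (simp add: xy_coeff_def fps_sum_nth mps_nth_sum)

lemma xy_coeff_of_nat_mult [simp]: "xy_coeff (of_nat m * a) \<mu> = of_nat m * xy_coeff a \<mu>"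
  by (induction m) (auto simp: algebra_simps)

lemma xy_coeff_mult: "xy_coeff (a * b) \<mu> = (\<Sum>(\<alpha>, \<beta>) \<in> {(\<alpha>, \<beta>). \<alpha> + \<beta> = \<mu>}. xy_coeff a \<alpha> * xy_coeff b \<beta>)"
proof -
  obtain m e where \<mu>: "\<mu> = (m, e)"
    by (cases \<mu>)
  let ?A = "{(d, d'). d + d' = e}"
  have "xy_coeff (a * b) \<mu> = (\<Sum>i=0..m. \<Sum>x\<in>?A. xy_coeff a (i, fst x) * xy_coeff b (m - i, snd x))"
    by (simp add: xy_coeff_def \<mu> fps_mult_nth mps_nth_sum mps_nth_times case_prod_unfold)
  also have "\<dots> = (\<Sum>(i, x)\<in>{0..m} \<times> ?A. xy_coeff a (i, fst x) * xy_coeff b (m - i, snd x))"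
    by (simp add: sum.cartesian_product)
  also have "\<dots> = (\<Sum>(\<alpha>, \<beta>) \<in> {(\<alpha>, \<beta>). \<alpha> + \<beta> = \<mu>}. xy_coeff a \<alpha> * xy_coeff b \<beta>)"
    by (rule sum.reindex_bij_witness[of _ "\<lambda>(\<alpha>, \<beta>). (fst \<alpha>, snd \<alpha>, snd \<beta>)"
          "\<lambda>(i, x). ((i, fst x), (m - i, snd x))"]) (auto simp: \<mu>)
  finally show ?thesis .
qed

text \<open>
  If only one decomposition of the exponent contributes, the coefficient of a product is a product
  of coefficients. All statements about leading terms below are instances of this.
\<close>

lemma xy_coeff_mult_single:
  assumes "\<And>\<alpha>' \<beta>'. \<alpha>' + \<beta>' = \<alpha> + \<beta> \<Longrightarrow> xy_coeff a \<alpha>' \<noteq> 0 \<Longrightarrow> xy_coeff b \<beta>' \<noteq> 0 \<Longrightarrow> \<alpha>' = \<alpha>"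
  shows "xy_coeff (a * b) (\<alpha> + \<beta>) = xy_coeff a \<alpha> * xy_coeff b \<beta>"
proof -
  have "xy_coeff (a * b) (\<alpha> + \<beta>) = (\<Sum>(\<alpha>', \<beta>') \<in> {(\<alpha>, \<beta>)}. xy_coeff a \<alpha>' * xy_coeff b \<beta>')"
    unfolding xy_coeff_mult
  proof (rule sum.mono_neutral_right[OF finite_xy_antidiagonal])
    have "xy_coeff a (fst p) * xy_coeff b (snd p) = 0" if "fst p + snd p = \<alpha> + \<beta>" "p \<noteq> (\<alpha>, \<beta>)" for p
      using assms[OF that(1)] that
      by (metis add_left_cancel mult_zero_left mult_zero_right prod.collapse)
    then show "\<forall>p\<in>{(\<alpha>', \<beta>'). \<alpha>' + \<beta>' = \<alpha> + \<beta>} - {(\<alpha>, \<beta>)}. (case p of (\<alpha>', \<beta>') \<Rightarrow> xy_coeff a \<alpha>' * xy_coeff b \<beta>') = 0"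
      by (simp add: case_prod_unfold)
  qed auto
  then show ?thesis
    by simp
qed

lemma xy_coeff_mult_nonzeroE:
  assumes "xy_coeff (a * b) \<mu> \<noteq> 0"
  obtains \<alpha> \<beta> where "\<mu> = \<alpha> + \<beta>" "xy_coeff a \<alpha> \<noteq> 0" "xy_coeff b \<beta> \<noteq> 0"
proof -
  obtain x where "x \<in> {(\<alpha>, \<beta>). \<alpha> + \<beta> = \<mu>}" "(case x of (\<alpha>, \<beta>) \<Rightarrow> xy_coeff a \<alpha> * xy_coeff b \<beta>) \<noteq> 0"
    using assms unfolding xy_coeff_mult by (rule sum.not_neutral_contains_not_neutral)
  then show thesis
    using that[of "fst x" "snd x"]
    by (metis (mono_tags, lifting) case_prod_unfold mem_Collect_eq mult_zero_left mult_zero_right)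
qed

section \<open>Weighted orders\<close>

definition wt :: "nat \<Rightarrow> nat \<Rightarrow> 'n xy_expo \<Rightarrow> nat" where
  "wt \<xi> \<eta> \<mu> = \<xi> * expo_deg (snd \<mu>) + \<eta> * fst \<mu>"

lemma wt_add [simp]: "wt \<xi> \<eta> (\<mu> + \<nu>) = wt \<xi> \<eta> \<mu> + wt \<xi> \<eta> \<nu>"
  by (simp add: wt_def algebra_simps)

lemma wt_zero [simp]: "wt \<xi> \<eta> 0 = 0"
  by (simp add: wt_def)

lemma wt_eq_0_iff: "0 < \<xi> \<Longrightarrow> 0 < \<eta> \<Longrightarrow> wt \<xi> \<eta> \<mu> = 0 \<longleftrightarrow> \<mu> = 0"
  by (cases \<mu>) (auto simp: wt_def zero_prod_def)

lemma finite_wt_le: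
  assumes "0 < \<xi>" "0 < \<eta>"
  shows "finite {\<mu> :: 'n xy_expo. wt \<xi> \<eta> \<mu> \<le> m}"
proof (rule finite_subset)
  show "finite ({..m} \<times> {e :: 'n expo. expo_deg e \<le> m})"
    by (intro finite_cartesian_product finite_expo_deg_le) auto
  show "{\<mu> :: 'n xy_expo. wt \<xi> \<eta> \<mu> \<le> m} \<subseteq> {..m} \<times> {e. expo_deg e \<le> m}"
  proof (clarsimp simp: wt_def)
    fix i and e :: "'n expo"
    assume le: "\<xi> * expo_deg e + \<eta> * i \<le> m"
    have "expo_deg e \<le> \<xi> * expo_deg e" "i \<le> \<eta> * i"
      using assms by auto
    with le show "i \<le> m \<and> expo_deg e \<le> m"
      by linarith
  qed
qed

definition expo_mult :: "nat \<Rightarrow> 'n xy_expo \<Rightarrow> 'n xy_expo" where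
  "expo_mult m \<mu> = ((+) \<mu> ^^ m) 0"

lemma expo_mult_simps [simp]: "expo_mult 0 \<mu> = 0" "expo_mult (Suc m) \<mu> = \<mu> + expo_mult m \<mu>"
  by (simp_all add: expo_mult_def)

lemma wt_expo_mult [simp]: "wt \<xi> \<eta> (expo_mult m \<mu>) = m * wt \<xi> \<eta> \<mu>"
  by (induction m) auto

lemma fst_expo_mult [simp]: "fst (expo_mult m \<mu>) = m * fst \<mu>"
  by (induction m) auto

lemma expo_deg_expo_mult [simp]: "expo_deg (snd (expo_mult m \<mu>)) = m * expo_deg (snd \<mu>)"
  by (induction m) auto

text \<open>
  The series of weighted order at least \<open>m\<close>, an ideal generated by monomials. The zero series
  has infinite order, so it lies in all of these ideals.
\<close>

definition val_ideal :: "nat \<Rightarrow> nat \<Rightarrow> nat \<Rightarrow> ('n, 'k :: comm_ring_1) mps fps set" where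
  "val_ideal \<xi> \<eta> m = {a. \<forall>\<mu>. xy_coeff a \<mu> \<noteq> 0 \<longrightarrow> m \<le> wt \<xi> \<eta> \<mu>}"

lemma val_idealI: "(\<And>\<mu>. xy_coeff a \<mu> \<noteq> 0 \<Longrightarrow> m \<le> wt \<xi> \<eta> \<mu>) \<Longrightarrow> a \<in> val_ideal \<xi> \<eta> m"
  unfolding val_ideal_def by blast

lemma val_idealD: "a \<in> val_ideal \<xi> \<eta> m \<Longrightarrow> xy_coeff a \<mu> \<noteq> 0 \<Longrightarrow> m \<le> wt \<xi> \<eta> \<mu>"
  unfolding val_ideal_def by blast

lemma val_ideal_cf_eq_0: "a \<in> val_ideal \<xi> \<eta> m \<Longrightarrow> wt \<xi> \<eta> \<mu> < m \<Longrightarrow> xy_coeff a \<mu> = 0"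
  by (metis val_idealD not_le)

lemma val_ideal_zero [simp]: "0 \<in> val_ideal \<xi> \<eta> m"
  by (simp add: val_ideal_def)

lemma val_ideal_0 [simp]: "a \<in> val_ideal \<xi> \<eta> 0"
  by (simp add: val_ideal_def)

lemma val_ideal_add: "a \<in> val_ideal \<xi> \<eta> m \<Longrightarrow> b \<in> val_ideal \<xi> \<eta> m \<Longrightarrow> a + b \<in> val_ideal \<xi> \<eta> m"
  by (rule val_idealI) (metis add_0 xy_coeff_simps(2) val_idealD)

lemma val_ideal_uminus: "a \<in> val_ideal \<xi> \<eta> m \<Longrightarrow> - a \<in> val_ideal \<xi> \<eta> m"
  by (simp add: val_ideal_def)

lemma val_ideal_diff: "a \<in> val_ideal \<xi> \<eta> m \<Longrightarrow> b \<in> val_ideal \<xi> \<eta> m \<Longrightarrow> a - b \<in> val_ideal \<xi> \<eta> m"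
  using val_ideal_add[of a \<xi> \<eta> m "- b"] val_ideal_uminus by fastforce

lemma val_ideal_sum: "(\<And>x. x \<in> A \<Longrightarrow> f x \<in> val_ideal \<xi> \<eta> m) \<Longrightarrow> sum f A \<in> val_ideal \<xi> \<eta> m"
  by (induction A rule: infinite_finite_induct) (auto intro: val_ideal_add)

lemma val_ideal_mono: "m \<le> m' \<Longrightarrow> a \<in> val_ideal \<xi> \<eta> m' \<Longrightarrow> a \<in> val_ideal \<xi> \<eta> m"
  by (auto simp: val_ideal_def intro: order_trans)

lemma val_ideal_mult:
  "a \<in> val_ideal \<xi> \<eta> m \<Longrightarrow> b \<in> val_ideal \<xi> \<eta> m' \<Longrightarrow> a * b \<in> val_ideal \<xi> \<eta> (m + m')"
  by (rule val_idealI, erule xy_coeff_mult_nonzeroE) (metis add_mono val_idealD wt_add)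

lemma val_ideal_mult_left: "b \<in> val_ideal \<xi> \<eta> m \<Longrightarrow> a * b \<in> val_ideal \<xi> \<eta> m"
  using val_ideal_mult[OF val_ideal_0] by force

lemma val_ideal_power: "a \<in> val_ideal \<xi> \<eta> m \<Longrightarrow> a ^ k \<in> val_ideal \<xi> \<eta> (k * m)"
  by (induction k) (auto intro: val_ideal_mult)

lemma is_ideal_val_ideal: "is_ideal (val_ideal \<xi> \<eta> m)"
  unfolding is_ideal_def module.subspace_def[OF module_mult]
  by (auto intro: val_ideal_add val_ideal_mult_left)

text \<open>
  Among the monomials of lowest weight in \<open>a\<close> let \<open>\<mu>\<close> be the largest in the lexicographic order. A
  sum of \<open>m\<close> exponents of \<open>a\<close> can only equal \<open>m\<mu>\<close> if each has lowest weight, hence is at most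
  \<open>\<mu>\<close>, hence equals \<open>\<mu>\<close>. So no cancellation can occur at \<open>m\<mu>\<close>.
\<close>

lemma xy_coeff_power_extreme:
  assumes a: "a \<in> val_ideal \<xi> \<eta> (wt \<xi> \<eta> \<mu>)"
    and max: "\<And>\<nu>. xy_coeff a \<nu> \<noteq> 0 \<Longrightarrow> wt \<xi> \<eta> \<nu> = wt \<xi> \<eta> \<mu> \<Longrightarrow> \<nu> \<le> \<mu>"
  shows "xy_coeff (a ^ m) (expo_mult m \<mu>) = xy_coeff a \<mu> ^ m"
proof -
  have "xy_coeff (a ^ m) (expo_mult m \<mu>) = xy_coeff a \<mu> ^ m \<and>
        (\<forall>\<nu>. xy_coeff (a ^ m) \<nu> \<noteq> 0 \<longrightarrow> wt \<xi> \<eta> \<nu> = m * wt \<xi> \<eta> \<mu> \<longrightarrow> \<nu> \<le> expo_mult m \<mu>)"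
  proof (induction m)
    case (Suc m)
    have am: "a ^ m \<in> val_ideal \<xi> \<eta> (m * wt \<xi> \<eta> \<mu>)"
      using a by (rule val_ideal_power)
    have split: "wt \<xi> \<eta> \<alpha> = wt \<xi> \<eta> \<mu> \<and> wt \<xi> \<eta> \<beta> = m * wt \<xi> \<eta> \<mu> \<and> \<alpha> \<le> \<mu> \<and> \<beta> \<le> expo_mult m \<mu>"
      if "wt \<xi> \<eta> (\<alpha> + \<beta>) = Suc m * wt \<xi> \<eta> \<mu>" "xy_coeff a \<alpha> \<noteq> 0" "xy_coeff (a ^ m) \<beta> \<noteq> 0" for \<alpha> \<beta>
    proof -
      have "wt \<xi> \<eta> \<mu> \<le> wt \<xi> \<eta> \<alpha>" "m * wt \<xi> \<eta> \<mu> \<le> wt \<xi> \<eta> \<beta>"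
        using val_idealD[OF a] val_idealD[OF am] that by auto
      with that(1) have "wt \<xi> \<eta> \<alpha> = wt \<xi> \<eta> \<mu>" "wt \<xi> \<eta> \<beta> = m * wt \<xi> \<eta> \<mu>"
        by auto
      with max Suc.IH that show ?thesis
        by blast
    qed
    have "xy_coeff (a * a ^ m) (\<mu> + expo_mult m \<mu>) = xy_coeff a \<mu> * xy_coeff (a ^ m) (expo_mult m \<mu>)"
    proof (rule xy_coeff_mult_single)
      fix \<alpha> \<beta>
      assume *: "\<alpha> + \<beta> = \<mu> + expo_mult m \<mu>" "xy_coeff a \<alpha> \<noteq> 0" "xy_coeff (a ^ m) \<beta> \<noteq> 0"
      have "wt \<xi> \<eta> (\<alpha> + \<beta>) = Suc m * wt \<xi> \<eta> \<mu>"
        by (simp add: * del: wt_add) simp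
      from split[OF this *(2,3)] have "\<alpha> \<le> \<mu>" "\<beta> \<le> expo_mult m \<mu>"
        by blast+
      then show "\<alpha> = \<mu>"
        using xy_expo_add_less[of \<alpha> \<mu> \<beta> "expo_mult m \<mu>"] *(1) by (metis less_irrefl order_le_imp_less_or_eq)
    qed
    moreover have "\<nu> \<le> \<mu> + expo_mult m \<mu>"
      if \<nu>: "xy_coeff (a * a ^ m) \<nu> \<noteq> 0" "wt \<xi> \<eta> \<nu> = Suc m * wt \<xi> \<eta> \<mu>" for \<nu>
    proof -
      obtain \<alpha> \<beta> where *: "\<nu> = \<alpha> + \<beta>" "xy_coeff a \<alpha> \<noteq> 0" "xy_coeff (a ^ m) \<beta> \<noteq> 0"
        using \<nu>(1) by (rule xy_coeff_mult_nonzeroE)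
      with split[of \<alpha> \<beta>] \<nu>(2) have "\<alpha> \<le> \<mu>" "\<beta> \<le> expo_mult m \<mu>"
        by auto
      then show ?thesis
        using *(1) xy_expo_add_mono by blast
    qed
    ultimately show ?case
      using Suc.IH by simp
  qed (auto simp: xy_coeff_one)
  then show ?thesis ..
qed

text \<open>
  For positive weights only finitely many monomials have a given weight, so a largest one exists.
  Comparing exponents of \<open>y\<close> first, \<open>\<mu>\<close> has the largest exponent of \<open>y\<close> in the initial form.
\<close>

lemma obtain_initial_exponent:
  fixes a :: "('n, 'k :: comm_ring_1) mps fps"
  assumes "0 < \<xi>" "0 < \<eta>" "xy_coeff a \<nu> \<noteq> 0"
  obtains \<mu> where "xy_coeff a \<mu> \<noteq> 0" "a \<in> val_ideal \<xi> \<eta> (wt \<xi> \<eta> \<mu>)"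
    "\<And>\<nu>. xy_coeff a \<nu> \<noteq> 0 \<Longrightarrow> wt \<xi> \<eta> \<nu> = wt \<xi> \<eta> \<mu> \<Longrightarrow> \<nu> \<le> \<mu>"
proof -
  define m where "m = (LEAST m. \<exists>\<nu>. xy_coeff a \<nu> \<noteq> 0 \<and> wt \<xi> \<eta> \<nu> = m)"
  have ex: "\<exists>\<nu>. xy_coeff a \<nu> \<noteq> 0 \<and> wt \<xi> \<eta> \<nu> = m"
    unfolding m_def by (rule LeastI_ex) (use assms(3) in blast)
  have least: "m \<le> wt \<xi> \<eta> \<nu>" if "xy_coeff a \<nu> \<noteq> 0" for \<nu>
    unfolding m_def by (rule Least_le) (use that in blast)
  define A where "A = {\<nu>. xy_coeff a \<nu> \<noteq> 0 \<and> wt \<xi> \<eta> \<nu> = m}"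
  have "finite A"
    by (rule finite_subset[OF _ finite_wt_le[OF assms(1,2), of m]]) (auto simp: A_def)
  moreover have "A \<noteq> {}"
    using ex by (auto simp: A_def)
  ultimately have "Max A \<in> A" "\<And>\<nu>. \<nu> \<in> A \<Longrightarrow> \<nu> \<le> Max A"
    by auto
  then show thesis
    using that[of "Max A"] least unfolding A_def by (metis (mono_tags, lifting) mem_Collect_eq val_idealI)
qed

text \<open>
  The weighted order is multiplicative on powers because the extreme monomial of the initial form
  survives in every power.
\<close>

lemma val_ideal_power_iff:
  fixes a :: "('n, 'k :: idom) mps fps"
  assumes "0 < \<xi>" "0 < \<eta>" "0 < k"
  shows "a ^ k \<in> val_ideal \<xi> \<eta> (k * m) \<longleftrightarrow> a \<in> val_ideal \<xi> \<eta> m"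
proof
  assume ak: "a ^ k \<in> val_ideal \<xi> \<eta> (k * m)"
  show "a \<in> val_ideal \<xi> \<eta> m"
  proof (rule val_idealI)
    fix \<nu>
    assume "xy_coeff a \<nu> \<noteq> 0"
    with assms obtain \<mu> where \<mu>: "xy_coeff a \<mu> \<noteq> 0" "a \<in> val_ideal \<xi> \<eta> (wt \<xi> \<eta> \<mu>)"
      "\<And>\<nu>. xy_coeff a \<nu> \<noteq> 0 \<Longrightarrow> wt \<xi> \<eta> \<nu> = wt \<xi> \<eta> \<mu> \<Longrightarrow> \<nu> \<le> \<mu>"
      using obtain_initial_exponent by blast
    have "xy_coeff (a ^ k) (expo_mult k \<mu>) \<noteq> 0"
      using xy_coeff_power_extreme[OF \<mu>(2,3), of k] \<mu>(1) by simp
    from val_idealD[OF ak this] have "k * m \<le> k * wt \<xi> \<eta> \<mu>"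
      by simp
    then have "m \<le> wt \<xi> \<eta> \<mu>"
      using \<open>0 < k\<close> by simp
    also have "\<dots> \<le> wt \<xi> \<eta> \<nu>"
      using val_idealD[OF \<mu>(2)] \<open>xy_coeff a \<nu> \<noteq> 0\<close> .
    finally show "m \<le> wt \<xi> \<eta> \<nu>" .
  qed
qed (rule val_ideal_power)

section \<open>Units, powers of the maximal ideal and orders of ideals\<close>

lemma is_ideal_gen_ideal: "is_ideal (gen_ideal S)"
  unfolding is_ideal_def gen_ideal_def by (rule module.subspace_span[OF module_mult])

lemma gen_ideal_superset: "x \<in> S \<Longrightarrow> x \<in> gen_ideal S"
  unfolding gen_ideal_def by (rule module.span_base[OF module_mult])

lemma gen_ideal_subset_iff: "is_ideal P \<Longrightarrow> gen_ideal S \<subseteq> P \<longleftrightarrow> S \<subseteq> P"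
  unfolding is_ideal_def gen_ideal_def
  using module.span_minimal[OF module_mult] module.span_superset[OF module_mult] by blast

lemma is_ideal_mult: "is_ideal P \<Longrightarrow> a \<in> P \<Longrightarrow> b * a \<in> P"
  by (simp add: is_ideal_def module.subspace_def[OF module_mult])

lemma is_ideal_ideal_pow: "is_ideal (ideal_pow M k)"
  by (cases k) (auto simp: is_ideal_gen_ideal, simp add: is_ideal_def module.subspace_def[OF module_mult])

lemma ideal_pow_Suc_subset: "ideal_pow M (Suc k) \<subseteq> ideal_pow M k"
  by (auto simp: gen_ideal_subset_iff is_ideal_ideal_pow is_ideal_mult)

lemma ideal_pow_antimono: "k \<le> m \<Longrightarrow> ideal_pow M m \<subseteq> ideal_pow M k"
  by (induction m rule: dec_induct) (use ideal_pow_Suc_subset in blast)+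

lemma le_ideal_ord_iff: "enat k \<le> ideal_ord J \<longleftrightarrow> J \<subseteq> ideal_pow max_ideal k"
proof
  assume le: "enat k \<le> ideal_ord J"
  show "J \<subseteq> ideal_pow max_ideal k"
  proof (cases k)
    case (Suc k')
    then have "enat k' < ideal_ord J"
      using le by (metis Suc_ile_eq)
    then obtain m where "k' < m" "J \<subseteq> ideal_pow max_ideal m"
      unfolding ideal_ord_def less_Sup_iff by auto
    then show ?thesis
      using ideal_pow_antimono[of k m] Suc by auto
  qed simp
qed (auto simp: ideal_ord_def intro: Sup_upper)

lemma mps_monom_nth: "mps_nth (mps_monom r) e = (if e = r then 1 else 0)"
  by (simp add: mps_monom_def)

definition mps_const :: "'k :: comm_ring_1 \<Rightarrow> ('n, 'k) mps" where
  "mps_const k = Abs_mps (\<lambda>e. if e = 0 then k else 0)"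

lemma mps_nth_times_single:
  assumes "\<And>d'. d' \<noteq> d \<Longrightarrow> mps_nth f d' = 0"
  shows "mps_nth (f * g) (d + e) = mps_nth f d * mps_nth g e"
proof -
  have "mps_nth (f * g) (d + e) = (\<Sum>(a, b) \<in> {(d, e)}. mps_nth f a * mps_nth g b)"
    unfolding mps_nth_times
    by (rule sum.mono_neutral_right[OF finite_expo_antidiagonal])
       (auto, metis add_left_cancel assms mult_zero_left, metis add_left_cancel assms mult_zero_left)
  then show ?thesis
    by simp
qed

lemma mps_nth_const_mult [simp]: "mps_nth (mps_const k * g) e = k * mps_nth g e"
  using mps_nth_times_single[of 0 "mps_const k" g e] by (simp add: mps_const_def)

lemma mps_const_power: "mps_const (k ^ m) = (mps_const k ^ m :: ('n, 'k :: comm_ring_1) mps)"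
proof (induction m)
  case 0
  show ?case
    by (simp add: mps_eq_iff mps_const_def mps_nth_one)
next
  case (Suc m)
  have "mps_const (k * k ^ m) = (mps_const k * mps_const (k ^ m) :: ('n, 'k) mps)"
    by (simp add: mps_eq_iff) (simp add: mps_const_def)
  then show ?case
    by (simp only: Suc.IH power_Suc)
qed

lemma mps_nth_times_0:
  fixes f g :: "('n, 'k :: comm_ring_1) mps"
  shows "mps_nth (f * g) 0 = mps_nth f 0 * mps_nth g 0"
proof -
  have "d = 0 \<and> d' = 0" if "d + d' = 0" for d d' :: "'n expo"
    using arg_cong[OF that, of expo_deg] by simp
  then have iff: "d + d' = 0 \<longleftrightarrow> d = 0 \<and> d' = 0" for d d' :: "'n expo"
    by (metis add_0)
  have "{(d, d'). d + d' = (0 :: 'n expo)} = {(0, 0)}"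
    unfolding iff by auto
  then show ?thesis
    unfolding mps_nth_times by simp
qed

lemma mps_power_nth_eq_0:
  assumes "mps_nth h 0 = 0" "expo_deg e < m"
  shows "mps_nth (h ^ m) e = 0"
  using assms(2)
proof (induction m arbitrary: e)
  case (Suc m)
  have "mps_nth h d * mps_nth (h ^ m) d' = 0" if "d + d' = e" for d d'
  proof (cases "d = 0")
    case False
    then have "0 < expo_deg d"
      by (metis expo_deg_eq_0_iff gr0I)
    then have "expo_deg d' < m"
      using Suc.prems that by auto
    with Suc.IH show ?thesis
      by simp
  qed (use assms(1) in simp)
  then show ?case
    by (simp add: mps_nth_times) (rule sum.neutral, auto)
qed simp

text \<open>
  The geometric series: \<open>h\<^sup>m\<close> contributes only in degrees at least \<open>m\<close>, so every coefficient of the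
  inverse is a finite sum.
\<close>

lemma mps_one_minus_unit:
  fixes h :: "('n, 'k :: comm_ring_1) mps"
  assumes "mps_nth h 0 = 0"
  shows "(1 - h) dvd 1"
proof -
  define b where "b = Abs_mps (\<lambda>e. \<Sum>m\<le>expo_deg e. mps_nth (h ^ m) e)"
  have b: "mps_nth b d' = (\<Sum>m\<le>expo_deg e. mps_nth (h ^ m) d')" if "d + d' = e" for d d' e
    unfolding b_def mps_nth_simps
    by (rule sum.mono_neutral_left) (use that mps_power_nth_eq_0[OF assms] in auto)
  have "mps_nth (h * b) e = (\<Sum>m\<le>expo_deg e. mps_nth (h ^ Suc m) e)" for e
  proof -
    have "mps_nth (h * b) e =
        (\<Sum>(d, d') \<in> {(d, d'). d + d' = e}. mps_nth h d * (\<Sum>m\<le>expo_deg e. mps_nth (h ^ m) d'))"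
      unfolding mps_nth_times
    proof (rule sum.cong[OF refl])
      fix x
      assume "x \<in> {(d, d'). d + d' = e}"
      with b[of "fst x" "snd x" e] show "(case x of (d, d') \<Rightarrow> mps_nth h d * mps_nth b d') =
          (case x of (d, d') \<Rightarrow> mps_nth h d * (\<Sum>m\<le>expo_deg e. mps_nth (h ^ m) d'))"
        by (simp add: case_prod_unfold)
    qed
    also have "\<dots> = (\<Sum>m\<le>expo_deg e. \<Sum>(d, d') \<in> {(d, d'). d + d' = e}. mps_nth h d * mps_nth (h ^ m) d')"
      by (simp add: sum_distrib_left case_prod_unfold) (rule sum.swap)
    finally show ?thesis
      by (simp add: mps_nth_times)
  qed
  moreover have "(\<Sum>m\<le>k. mps_nth (h ^ m) e) = mps_nth 1 e + (\<Sum>m\<le>k. mps_nth (h ^ Suc m) e) - mps_nth (h ^ Suc k) e"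
    for e k
    by (induction k) (auto simp: algebra_simps)
  ultimately have "mps_nth ((1 - h) * b) e = mps_nth 1 e" for e
    using mps_power_nth_eq_0[OF assms, of e "Suc (expo_deg e)"] b[of 0 e e]
    by (simp add: left_diff_distrib del: power_Suc)
  then have "(1 - h) * b = 1"
    by (simp add: mps_eq_iff)
  then show ?thesis
    by (metis dvd_triv_left)
qed

lemma mps_is_unit_iff:
  fixes f :: "('n, 'k :: field) mps"
  shows "f dvd 1 \<longleftrightarrow> mps_nth f 0 \<noteq> 0"
proof
  assume "f dvd 1"
  then obtain b where "1 = f * b" ..
  then have "1 = mps_nth f 0 * mps_nth b 0"
    by (metis mps_nth_one mps_nth_times_0)
  then show "mps_nth f 0 \<noteq> 0"
    by auto
next
  assume nz: "mps_nth f 0 \<noteq> 0"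
  define h where "h = 1 - mps_const (inverse (mps_nth f 0)) * f"
  have "(1 - h) dvd 1"
    by (rule mps_one_minus_unit) (use nz in \<open>simp add: h_def mps_nth_one\<close>)
  then show "f dvd 1"
    by (simp add: h_def dvd_mult_right)
qed

lemma xy_nonunit_imp_cf_0:
  fixes a :: "('n, 'k :: field) mps fps"
  assumes "\<not> a dvd 1"
  shows "xy_coeff a 0 = 0"
proof (rule ccontr)
  assume "xy_coeff a 0 \<noteq> 0"
  then have "fps_nth a 0 dvd 1"
    by (simp add: mps_is_unit_iff xy_coeff_def)
  then obtain y where "1 = fps_nth a 0 * y" ..
  then have "a * fps_right_inverse a y = 1"
    by (intro fps_right_inverse) simp
  with assms show False
    by (metis dvd_triv_left)
qed

lemma mps_mult_nonzeroE:
  assumes "mps_nth (a * b) e \<noteq> 0"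
  obtains d d' where "e = d + d'" "mps_nth a d \<noteq> 0" "mps_nth b d' \<noteq> 0"
proof -
  obtain x where "x \<in> {(d, d'). d + d' = e}" "(case x of (d, d') \<Rightarrow> mps_nth a d * mps_nth b d') \<noteq> 0"
    using assms unfolding mps_nth_times by (rule sum.not_neutral_contains_not_neutral)
  then show thesis
    using that[of "fst x" "snd x"]
    by (metis (mono_tags, lifting) case_prod_unfold mem_Collect_eq mult_zero_left mult_zero_right)
qed

definition ord_ideal :: "nat \<Rightarrow> ('n, 'k :: comm_ring_1) mps set" where
  "ord_ideal k = {a. \<forall>e. mps_nth a e \<noteq> 0 \<longrightarrow> k \<le> expo_deg e}"

lemma ord_ideal_mult:
  assumes "a \<in> ord_ideal k" "b \<in> ord_ideal m"
  shows "a * b \<in> ord_ideal (k + m)"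
  unfolding ord_ideal_def
proof clarify
  fix e
  assume "mps_nth (a * b) e \<noteq> 0"
  then obtain d d' where "e = d + d'" "mps_nth a d \<noteq> 0" "mps_nth b d' \<noteq> 0"
    by (rule mps_mult_nonzeroE)
  then show "k + m \<le> expo_deg e"
    using assms by (auto simp: ord_ideal_def intro!: add_mono)
qed

lemma is_ideal_ord_ideal: "is_ideal (ord_ideal k)"
  unfolding is_ideal_def module.subspace_def[OF module_mult]
proof (intro conjI ballI allI)
  show "a * b \<in> ord_ideal k" if "b \<in> ord_ideal k" for a b :: "('a, 'b) mps"
    using ord_ideal_mult[of a 0 b k] that by (simp add: ord_ideal_def)
  show "a + b \<in> ord_ideal k" if "a \<in> ord_ideal k" "b \<in> ord_ideal k" for a b :: "('a, 'b) mps"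
    using that by (auto simp: ord_ideal_def) (metis add_0)
qed (simp add: ord_ideal_def)

definition expo_unit :: "nat \<Rightarrow> 'n expo" where
  "expo_unit i = Abs_expo (\<lambda>j. if j = i \<and> i < CARD('n) then 1 else 0)"

lemma expo_nth_unit: "expo_nth (expo_unit i :: 'n expo) j = (if j = i \<and> i < CARD('n) then 1 else 0)"
  unfolding expo_unit_def by (subst Abs_expo_inverse) auto

text \<open>
  Each monomial occurring in \<open>a\<close> is divided by the first variable that divides it.
\<close>

lemma ord_ideal_Suc_decompose:
  fixes a :: "('n, 'k :: comm_ring_1) mps"
  assumes "a \<in> ord_ideal (Suc k)"
  shows "\<exists>b. a = (\<Sum>i<CARD('n). mps_monom (expo_unit i) * b i) \<and> (\<forall>i<CARD('n). b i \<in> ord_ideal k)"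
proof -
  define b where "b = (\<lambda>i. Abs_mps (\<lambda>e. if \<forall>j<i. expo_nth e j = 0 then mps_nth a (expo_unit i + e) else 0))"
  have nth: "mps_nth (mps_monom (expo_unit i) * b i) e =
      (if expo_nth e i \<noteq> 0 \<and> (\<forall>j<i. expo_nth e j = 0) then mps_nth a e else 0)"
    if i: "i < CARD('n)" for i e
  proof (cases "expo_nth e i = 0")
    case True
    have "mps_nth (mps_monom (expo_unit i) :: ('n, 'k) mps) d * mps_nth (b i) d' = 0" if "d + d' = e" for d d'
      using True i that by (auto simp: mps_monom_nth expo_nth_unit)
    then show ?thesis
      using True by (simp add: mps_nth_times) (rule sum.neutral, auto)
  next
    case False
    then have e: "e = expo_unit i + (e - expo_unit i)"
      by (intro expo_eqI) (auto simp: expo_nth_unit)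
    have "mps_nth (mps_monom (expo_unit i) * b i) e = mps_nth (b i) (e - expo_unit i)"
      by (subst e, subst mps_nth_times_single) (auto simp: mps_monom_nth)
    also have "\<dots> = (if \<forall>j<i. expo_nth e j = 0 then mps_nth a e else 0)"
      using e by (auto simp: b_def expo_nth_unit)
    finally show ?thesis
      using False by simp
  qed
  have "mps_nth a e = (\<Sum>i<CARD('n). mps_nth (mps_monom (expo_unit i) * b i) e)" for e
  proof (cases "e = 0")
    case True
    with assms have "mps_nth a e = 0"
      by (auto simp: ord_ideal_def)
    with True show ?thesis
      by (simp add: nth)
  next
    case False
    then obtain j where "expo_nth e j \<noteq> 0"
      by (metis expo_eqI expo_nth_zero)
    define m where "m = (LEAST j. expo_nth e j \<noteq> 0)"
    have m: "expo_nth e m \<noteq> 0" "\<And>j. j < m \<Longrightarrow> expo_nth e j = 0"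
      unfolding m_def using \<open>expo_nth e j \<noteq> 0\<close> by (metis (mono_tags) LeastI not_less_Least)+
    then have "m < CARD('n)"
      using expo_nth_outside by (metis not_le)
    have "(\<Sum>i<CARD('n). mps_nth (mps_monom (expo_unit i) * b i) e) = (\<Sum>i<CARD('n). if i = m then mps_nth a e else 0)"
      by (rule sum.cong) (use m nth in \<open>auto simp: nat_neq_iff\<close>)
    then show ?thesis
      using \<open>m < CARD('n)\<close> by simp
  qed
  then have "a = (\<Sum>i<CARD('n). mps_monom (expo_unit i) * b i)"
    by (simp add: mps_eq_iff mps_nth_sum)
  moreover have "b i \<in> ord_ideal k" if "i < CARD('n)" for i
  proof -
    have "expo_deg (expo_unit i :: 'n expo) = 1"
      using that by (simp add: expo_deg_def expo_nth_unit)
    then show ?thesis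
      using assms unfolding ord_ideal_def b_def by (auto split: if_splits)
  qed
  ultimately show ?thesis
    by blast
qed

lemma ideal_pow_max_ideal_mps:
  "ideal_pow max_ideal k = (ord_ideal k :: ('n, 'k :: field) mps set)"
proof (induction k)
  case 0
  then show ?case
    by (simp add: ord_ideal_def)
next
  case (Suc k)
  have max: "max_ideal = (ord_ideal 1 :: ('n, 'k) mps set)"
  proof -
    have "mps_nth a 0 = 0 \<longleftrightarrow> a \<in> ord_ideal 1" for a :: "('n, 'k) mps"
      unfolding ord_ideal_def using expo_deg_eq_0_iff by (auto simp: Suc_le_eq) (metis expo_deg_eq_0_iff gr0I)
    then show ?thesis
      by (auto simp: max_ideal_def mps_is_unit_iff)
  qed
  let ?S = "{a * b | a b. a \<in> max_ideal \<and> b \<in> (ord_ideal k :: ('n, 'k) mps set)}"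
  have "gen_ideal ?S \<subseteq> ord_ideal (Suc k)"
    by (auto simp: gen_ideal_subset_iff is_ideal_ord_ideal max dest: ord_ideal_mult)
  moreover have "a \<in> gen_ideal ?S" if "a \<in> ord_ideal (Suc k)" for a
  proof -
    obtain b where a: "a = (\<Sum>i<CARD('n). mps_monom (expo_unit i) * b i)"
      and b: "\<And>i. i < CARD('n) \<Longrightarrow> b i \<in> ord_ideal k"
      using ord_ideal_Suc_decompose[OF \<open>a \<in> ord_ideal (Suc k)\<close>] by blast
    have "(mps_monom (expo_unit i) :: ('n, 'k) mps) \<in> max_ideal" if "i < CARD('n)" for i
      using that unfolding max by (auto simp: ord_ideal_def mps_monom_nth expo_deg_def expo_nth_unit)
    then have "mps_monom (expo_unit i) * b i \<in> gen_ideal ?S" if "i < CARD('n)" for i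
      using that b by (intro gen_ideal_superset) blast
    then show ?thesis
      unfolding a gen_ideal_def by (intro module.span_sum[OF module_mult]) auto
  qed
  ultimately show ?case
    using Suc.IH by auto
qed

lemma le_mps_ideal_ord_iff:
  fixes J :: "('n, 'k :: field) mps set"
  shows "enat k \<le> ideal_ord J \<longleftrightarrow> J \<subseteq> ord_ideal k"
  by (simp add: le_ideal_ord_iff ideal_pow_max_ideal_mps)

text \<open>
  This turns the order conditions on \<open>g\<close> and on \<open>I\<^sub>-\<^sub>1\<close> into conditions on monomials. It holds
  because a series with nonzero constant term is a unit.
\<close>

lemma ideal_pow_max_ideal_xy:
  "ideal_pow max_ideal k \<subseteq> (val_ideal 1 1 k :: ('n, 'k :: field) mps fps set)"
proof (induction k)
  case 0
  then show ?case
    by auto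
next
  case (Suc k)
  have "max_ideal \<subseteq> (val_ideal 1 1 1 :: ('n, 'k) mps fps set)"
  proof
    fix a :: "('n, 'k) mps fps"
    assume "a \<in> max_ideal"
    then have "xy_coeff a 0 = 0"
      by (simp add: max_ideal_def xy_nonunit_imp_cf_0)
    then show "a \<in> val_ideal 1 1 1"
      by (intro val_idealI) (metis One_nat_def less_one not_less_eq_eq not_less_zero wt_eq_0_iff zero_less_one le_zero_eq not_le)
  qed
  with Suc.IH show ?case
    by (auto simp: gen_ideal_subset_iff is_ideal_val_ideal dest!: subsetD dest: val_ideal_mult)
qed

section \<open>Orders of coefficient ideals\<close>

lemma mult_div_fact: "i < c \<Longrightarrow> (fact c div (c - i)) * (c - i) = (fact c :: nat)"
  by (rule dvd_div_mult_self) (auto intro: dvd_fact)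

text \<open>
  The exponents \<open>c!/(c-i)\<close> of the coefficient ideal are chosen such that an order \<open>(c-i)m\<close> of the
  coefficient of \<open>w\<^sup>i\<close> becomes \<open>c!m\<close> for all \<open>i\<close>. The equivalence holds for any filtration that is
  multiplicative on powers, and it is used for weighted orders on \<open>K[[\<^bold>x,y]]\<close> and for the order on
  \<open>K[[\<^bold>x]]\<close>.
\<close>

lemma coeff_ideal_subset_iff:
  fixes P :: "nat \<Rightarrow> 'a :: comm_ring_1 set"
  assumes "is_ideal (P (fact c * m))"
    and power: "\<And>a k l. 0 < k \<Longrightarrow> a ^ k \<in> P (k * l) \<longleftrightarrow> a \<in> P l"
  shows "coeff_ideal c J \<subseteq> P (fact c * m) \<longleftrightarrow> (\<forall>f\<in>J. \<forall>i<c. fps_nth f i \<in> P ((c - i) * m))"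
proof -
  have "fps_nth f i ^ (fact c div (c - i)) \<in> P (fact c * m) \<longleftrightarrow> fps_nth f i \<in> P ((c - i) * m)"
    if "i < c" for f :: "'a fps" and i
  proof -
    have "fact c div (c - i) > 0"
      using mult_div_fact[OF that] by (metis fact_nonzero gr0I mult_zero_left)
    from power[OF this, of "fps_nth f i" "(c - i) * m"] show ?thesis
      unfolding mult.assoc[symmetric] mult_div_fact[OF that] .
  qed
  then show ?thesis
    unfolding coeff_ideal_def gen_ideal_subset_iff[OF assms(1)] by blast
qed

lemma coeff_ideal_xy_subset_iff:
  fixes J :: "('n, 'k :: idom) mps fps fps set"
  assumes "0 < \<xi>" "0 < \<eta>"
  shows "coeff_ideal c J \<subseteq> val_ideal \<xi> \<eta> (fact c * m) \<longleftrightarrow>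
           (\<forall>f\<in>J. \<forall>i<c. fps_nth f i \<in> val_ideal \<xi> \<eta> ((c - i) * m))"
  by (intro coeff_ideal_subset_iff is_ideal_val_ideal val_ideal_power_iff assms)

text \<open>
  The condition \<open>ord a \<ge> m/l\<close>, needed for the possibly fractional bounds \<open>(d-j)s/d!\<close>.
\<close>

definition scaled_ord_ideal :: "nat \<Rightarrow> nat \<Rightarrow> ('n, 'k :: comm_ring_1) mps set" where
  "scaled_ord_ideal l m = {a. \<forall>e. mps_nth a e \<noteq> 0 \<longrightarrow> m \<le> l * expo_deg e}"

lemma scaled_ord_ideal_eq: "scaled_ord_ideal l m = {a. fps_const a \<in> val_ideal l 1 m}"
  by (auto simp: scaled_ord_ideal_def val_ideal_def wt_def xy_coeff_def)

lemma coeff_ideal_mps_subset_iff: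
  fixes I :: "('n, 'k :: field) mps fps set"
  shows "enat k \<le> ideal_ord (coeff_ideal d I) \<longleftrightarrow>
           (\<forall>a\<in>I. \<forall>j<d. \<forall>e. xy_coeff a (j, e) \<noteq> 0 \<longrightarrow> (d - j) * k \<le> fact d * expo_deg e)"
proof -
  have eq: "ord_ideal k = scaled_ord_ideal (fact d) (fact d * k)"
    by (auto simp: ord_ideal_def scaled_ord_ideal_def)
  have "coeff_ideal d I \<subseteq> scaled_ord_ideal (fact d) (fact d * k) \<longleftrightarrow>
      (\<forall>f\<in>I. \<forall>i<d. fps_nth f i \<in> scaled_ord_ideal (fact d) ((d - i) * k))"
  proof (rule coeff_ideal_subset_iff)
    show "is_ideal (scaled_ord_ideal (fact d) (fact d * k) :: ('n, 'k) mps set)"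
      unfolding eq[symmetric] by (rule is_ideal_ord_ideal)
    show "a ^ m \<in> scaled_ord_ideal (fact d) (m * l) \<longleftrightarrow> a \<in> scaled_ord_ideal (fact d) l"
      if "0 < m" for a :: "('n, 'k) mps" and m l
      using val_ideal_power_iff[of "fact d" 1 m "fps_const a" l] that
      by (simp add: scaled_ord_ideal_eq fps_const_power)
  qed
  then show ?thesis
    by (simp add: le_mps_ideal_ord_iff eq) (simp add: scaled_ord_ideal_def xy_coeff_def)
qed

lemma xy_coeff_xy_monom: "xy_coeff (xy_monom r r_y) \<mu> = (if \<mu> = (r_y, r) then 1 else 0)"
  by (cases \<mu>) (auto simp: xy_coeff_def xy_monom_def mps_monom_nth fps_X_power_nth)

lemma xy_coeff_xy_monom_mult: "xy_coeff (xy_monom r r_y * a) ((r_y, r) + \<mu>) = xy_coeff a \<mu>"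
  by (subst xy_coeff_mult_single) (auto simp: xy_coeff_xy_monom split: if_splits)

lemma xy_monom_mult_in_val_ideal_iff:
  "xy_monom r r_y * a \<in> val_ideal \<xi> \<eta> (wt \<xi> \<eta> (r_y, r) + m) \<longleftrightarrow> a \<in> val_ideal \<xi> \<eta> m"
proof
  assume *: "xy_monom r r_y * a \<in> val_ideal \<xi> \<eta> (wt \<xi> \<eta> (r_y, r) + m)"
  show "a \<in> val_ideal \<xi> \<eta> m"
  proof (rule val_idealI)
    fix \<mu>
    assume "xy_coeff a \<mu> \<noteq> 0"
    then have "wt \<xi> \<eta> (r_y, r) + m \<le> wt \<xi> \<eta> ((r_y, r) + \<mu>)"
      by (intro val_idealD[OF *]) (simp only: xy_coeff_xy_monom_mult not_False_eq_True)
    then show "m \<le> wt \<xi> \<eta> \<mu>"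
      by (simp only: wt_add)
  qed
next
  have "xy_monom r r_y \<in> val_ideal \<xi> \<eta> (wt \<xi> \<eta> (r_y, r))"
    by (rule val_idealI) (simp add: xy_coeff_xy_monom split: if_splits)
  then show "a \<in> val_ideal \<xi> \<eta> m \<Longrightarrow> xy_monom r r_y * a \<in> val_ideal \<xi> \<eta> (wt \<xi> \<eta> (r_y, r) + m)"
    by (rule val_ideal_mult)
qed

section \<open>The coordinate change\<close>

text \<open>
  In lowest order, multiplication by \<open>u\<close> is multiplication by its constant term.
\<close>

lemma xy_coeff_unit_mult:
  assumes "0 < \<xi>" "0 < \<eta>" "h \<in> val_ideal \<xi> \<eta> (wt \<xi> \<eta> \<nu>)"
  shows "xy_coeff (u * h) \<nu> = xy_coeff u 0 * xy_coeff h \<nu>"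
proof -
  have "xy_coeff (u * h) (0 + \<nu>) = xy_coeff u 0 * xy_coeff h \<nu>"
  proof (rule xy_coeff_mult_single)
    fix \<alpha> \<beta>
    assume "\<alpha> + \<beta> = 0 + \<nu>" "xy_coeff h \<beta> \<noteq> 0"
    then have "wt \<xi> \<eta> \<alpha> + wt \<xi> \<eta> \<beta> \<le> wt \<xi> \<eta> \<beta>"
      using val_idealD[OF assms(3)] by (metis add_0 wt_add)
    then show "\<alpha> = 0"
      using wt_eq_0_iff[OF assms(1,2), of \<alpha>] by simp
  qed
  then show ?thesis
    by simp
qed

text \<open>
  The initial form of a power depends only on the initial form of the base.
\<close>

lemma val_ideal_power_cong:
  assumes "a - b \<in> val_ideal \<xi> \<eta> (Suc m)" "a \<in> val_ideal \<xi> \<eta> m" "b \<in> val_ideal \<xi> \<eta> m"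
  shows "a ^ k - b ^ k \<in> val_ideal \<xi> \<eta> (Suc (k * m))"
proof (induction k)
  case (Suc k)
  have "a ^ Suc k - b ^ Suc k = a * (a ^ k - b ^ k) + (a - b) * b ^ k"
    by (simp add: algebra_simps)
  moreover have "a * (a ^ k - b ^ k) \<in> val_ideal \<xi> \<eta> (Suc (Suc k * m))"
    using val_ideal_mult[OF assms(2) Suc.IH] by simp
  moreover have "(a - b) * b ^ k \<in> val_ideal \<xi> \<eta> (Suc (Suc k * m))"
    using val_ideal_mult[OF assms(1) val_ideal_power[OF assms(3), of k]] by simp
  ultimately show ?case
    by (metis val_ideal_add)
qed simp

text \<open>
  The terms with \<open>k > c\<close> contain a power of \<open>g\<close> of exponent at least \<open>c+1-i\<close>; so for every
  monomial of weight less than \<open>(c+1-i)m\<close> only the terms with \<open>i \<le> k \<le> c\<close> contribute.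
\<close>

lemma z_shift_truncate:
  assumes g: "g \<in> val_ideal \<xi> \<eta> m" and "i \<le> c"
  shows "fps_nth (z_shift g f) i - (\<Sum>k=i..c. of_nat (k choose i) * fps_nth f k * g ^ (k - i))
           \<in> val_ideal \<xi> \<eta> ((Suc c - i) * m)"
proof (rule val_idealI, rule ccontr)
  fix \<nu>
  let ?t = "\<lambda>k. of_nat (k choose i) * fps_nth f k * g ^ (k - i)"
  assume nz: "xy_coeff (fps_nth (z_shift g f) i - (\<Sum>k=i..c. ?t k)) \<nu> \<noteq> 0"
    and "\<not> (Suc c - i) * m \<le> wt \<xi> \<eta> \<nu>"
  then have less: "wt \<xi> \<eta> \<nu> < (Suc c - i) * m"
    by simp
  have large: "xy_coeff (?t k) \<nu> = 0" if "c < k" for k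
  proof (rule val_ideal_cf_eq_0)
    show "?t k \<in> val_ideal \<xi> \<eta> ((k - i) * m)"
      by (intro val_ideal_mult_left val_ideal_power g)
    have "(Suc c - i) * m \<le> (k - i) * m"
      using that by (intro mult_right_mono) auto
    with less show "wt \<xi> \<eta> \<nu> < (k - i) * m"
      by linarith
  qed
  have small: "xy_coeff (?t k) \<nu> = 0" if "k < i" for k
    using that by (simp add: binomial_eq_0)
  have "{k. xy_coeff (?t k) \<nu> \<noteq> 0} \<subseteq> {i..c}"
  proof
    fix k
    assume "k \<in> {k. xy_coeff (?t k) \<nu> \<noteq> 0}"
    then show "k \<in> {i..c}"
      using large[of k] small[of k] by (cases "k < i"; cases "c < k") (auto simp del: xy_coeff_of_nat_mult)
  qed
  then have "Sum_any (\<lambda>k. xy_coeff (?t k) \<nu>) = (\<Sum>k=i..c. xy_coeff (?t k) \<nu>)"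
    by (intro Sum_any.expand_superset) auto
  with nz show False
    by (simp add: z_shift_def xy_coeff_sum) (simp add: xy_coeff_def)
qed

text \<open>
  Descending induction on \<open>i\<close>: the relation for index \<open>i\<close> expresses \<open>f\<^sub>i\<close> by \<open>f'\<^sub>i\<close> and the \<open>f\<^sub>k\<close> with
  \<open>k > i\<close>.
\<close>

lemma z_shift_val_ideal_back:
  assumes g: "g \<in> val_ideal \<xi> \<eta> m"
    and shift: "\<And>i. i < c \<Longrightarrow> fps_nth (z_shift g f) i \<in> val_ideal \<xi> \<eta> ((c - i) * m)"
    and "i < c"
  shows "fps_nth f i \<in> val_ideal \<xi> \<eta> ((c - i) * m)"
  using \<open>i < c\<close>
proof (induction "c - i" arbitrary: i rule: less_induct)
  case less
  let ?t = "\<lambda>k. of_nat (k choose i) * fps_nth f k * g ^ (k - i)"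
  let ?P = "val_ideal \<xi> \<eta> ((c - i) * m)"
  have "?t k \<in> ?P" if "k \<in> {Suc i..c}" for k
  proof -
    have "fps_nth f k \<in> val_ideal \<xi> \<eta> ((c - k) * m)"
      using less that by (cases "k = c") auto
    then have "?t k \<in> val_ideal \<xi> \<eta> ((c - k) * m + (k - i) * m)"
      by (intro val_ideal_mult val_ideal_mult_left val_ideal_power g)
    then show ?thesis
      using that by (simp flip: add_mult_distrib)
  qed
  then have rest: "(\<Sum>k=Suc i..c. ?t k) \<in> ?P"
    by (rule val_ideal_sum)
  have trunc: "fps_nth (z_shift g f) i - (\<Sum>k=i..c. ?t k) \<in> ?P"
    by (rule val_ideal_mono[OF _ z_shift_truncate[OF g]]) (use less in auto)
  have "(\<Sum>k=i..c. ?t k) = fps_nth f i + (\<Sum>k=Suc i..c. ?t k)"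
    using less by (subst sum.atLeast_Suc_atMost) auto
  then have "fps_nth f i = fps_nth (z_shift g f) i - (fps_nth (z_shift g f) i - (\<Sum>k=i..c. ?t k)) - (\<Sum>k=Suc i..c. ?t k)"
    by simp
  also have "\<dots> \<in> ?P"
    using val_ideal_diff[OF val_ideal_diff[OF shift[OF less.prems] trunc] rest] .
  finally show ?case .
qed

text \<open>
  The coefficient of \<open>z'\<^sup>i\<close> in \<open>u(z' + g - g)\<^sup>c = uz'\<^sup>c\<close>.
\<close>

lemma binomial_shift_cancel:
  fixes u g :: "'a :: comm_ring_1"
  assumes "i < c"
  shows "(\<Sum>k=i..c. of_nat (k choose i) * (of_nat (c choose k) * u * (- g) ^ (c - k)) * g ^ (k - i)) = 0"
proof -
  have "(\<Sum>k=i..c. of_nat (k choose i) * (of_nat (c choose k) * u * (- g) ^ (c - k)) * g ^ (k - i)) =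
        (\<Sum>k=i..c. of_nat (c choose i) * u * (of_nat ((c - i) choose (k - i)) * g ^ (k - i) * (- g) ^ (c - k)))"
  proof (rule sum.cong[OF refl])
    fix k
    assume "k \<in> {i..c}"
    then have eq: "(of_nat (k choose i) * of_nat (c choose k) :: 'a) = of_nat (c choose i) * of_nat ((c - i) choose (k - i))"
      using choose_mult[of i k c] by (metis atLeastAtMost_iff mult.commute of_nat_mult)
    have "of_nat (k choose i) * (of_nat (c choose k) * u * (- g) ^ (c - k)) * g ^ (k - i) =
        (of_nat (k choose i) * of_nat (c choose k)) * (u * (g ^ (k - i) * (- g) ^ (c - k)))"
      by (simp only: ac_simps)
    also have "\<dots> = of_nat (c choose i) * u * (of_nat ((c - i) choose (k - i)) * g ^ (k - i) * (- g) ^ (c - k))"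
      unfolding eq by (simp only: ac_simps)
    finally show "of_nat (k choose i) * (of_nat (c choose k) * u * (- g) ^ (c - k)) * g ^ (k - i) =
        of_nat (c choose i) * u * (of_nat ((c - i) choose (k - i)) * g ^ (k - i) * (- g) ^ (c - k))" .
  qed
  also have "\<dots> = of_nat (c choose i) * u * (\<Sum>k=i..c. of_nat ((c - i) choose (k - i)) * g ^ (k - i) * (- g) ^ (c - k))"
    by (simp add: sum_distrib_left)
  also have "(\<Sum>k=i..c. of_nat ((c - i) choose (k - i)) * g ^ (k - i) * (- g) ^ (c - k)) =
      (\<Sum>l\<le>c - i. of_nat ((c - i) choose l) * g ^ l * (- g) ^ ((c - i) - l))"
    by (rule sum.reindex_bij_witness[of _ "\<lambda>l. i + l" "\<lambda>k. k - i"]) (use assms in auto)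
  also have "\<dots> = (g + - g) ^ (c - i)"
    by (rule binomial_ring[symmetric])
  finally show ?thesis
    using assms by (simp add: power_0_left)
qed

text \<open>
  If the coefficients of \<open>f(z' + g)\<close> below \<open>z'\<^sup>c\<close> vanish in lowest order, then in lowest order
  \<open>f(z' + g)\<close> is \<open>f\<^sub>cz'\<^sup>c\<close>, and \<open>f\<close> is \<open>f\<^sub>c(z - g)\<^sup>c\<close>. The proof is again a descending induction
  on \<open>i\<close>, in which the main terms cancel by \<open>binomial_shift_cancel\<close>.
\<close>

lemma z_shift_initial_form:
  assumes g: "g \<in> val_ideal \<xi> \<eta> m" and "0 < m"
    and shift: "\<And>i. i < c \<Longrightarrow> fps_nth (z_shift g f) i \<in> val_ideal \<xi> \<eta> (Suc ((c - i) * m))"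
    and "i \<le> c"
  shows "fps_nth f i - of_nat (c choose i) * fps_nth f c * (- g) ^ (c - i) \<in> val_ideal \<xi> \<eta> (Suc ((c - i) * m))"
  using \<open>i \<le> c\<close>
proof (induction "c - i" arbitrary: i rule: less_induct)
  case less
  show ?case
  proof (cases "i = c")
    case False
    with less have "i < c"
      by simp
    define E where "E = (\<lambda>k. fps_nth f k - of_nat (c choose k) * fps_nth f c * (- g) ^ (c - k))"
    let ?t = "\<lambda>k. of_nat (k choose i) * fps_nth f k * g ^ (k - i)"
    let ?e = "\<lambda>k. of_nat (k choose i) * E k * g ^ (k - i)"
    let ?P = "val_ideal \<xi> \<eta> (Suc ((c - i) * m))"
    have "?e k \<in> ?P" if "k \<in> {Suc i..c}" for k
    proof -
      have "E k \<in> val_ideal \<xi> \<eta> (Suc ((c - k) * m))"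
        unfolding E_def using less that by auto
      then have "?e k \<in> val_ideal \<xi> \<eta> (Suc ((c - k) * m) + (k - i) * m)"
        by (intro val_ideal_mult val_ideal_mult_left val_ideal_power g)
      then show ?thesis
        using that by (simp flip: add_mult_distrib)
    qed
    then have rest: "(\<Sum>k=Suc i..c. ?e k) \<in> ?P"
      by (rule val_ideal_sum)
    have trunc: "fps_nth (z_shift g f) i - (\<Sum>k=i..c. ?t k) \<in> ?P"
    proof (rule val_ideal_mono[OF _ z_shift_truncate[OF g]])
      show "Suc ((c - i) * m) \<le> (Suc c - i) * m"
        using \<open>i < c\<close> \<open>0 < m\<close> by (simp add: Suc_diff_le)
    qed (use less in auto)
    have "(\<Sum>k=i..c. ?t k) = E i + (\<Sum>k=Suc i..c. ?e k)"
    proof -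
      have "(\<Sum>k=i..c. ?t k) = (\<Sum>k=i..c. ?e k) +
          (\<Sum>k=i..c. of_nat (k choose i) * (of_nat (c choose k) * fps_nth f c * (- g) ^ (c - k)) * g ^ (k - i))"
        unfolding sum.distrib[symmetric] by (rule sum.cong) (simp_all add: E_def algebra_simps)
      also have "\<dots> = (\<Sum>k=i..c. ?e k)"
        using binomial_shift_cancel[OF \<open>i < c\<close>, of "fps_nth f c" g] by simp
      finally show ?thesis
        using less by (simp add: sum.atLeast_Suc_atMost)
    qed
    then have "E i = fps_nth (z_shift g f) i - (fps_nth (z_shift g f) i - (\<Sum>k=i..c. ?t k)) - (\<Sum>k=Suc i..c. ?e k)"
      by simp
    also have "\<dots> \<in> ?P"
      using val_ideal_diff[OF val_ideal_diff[OF shift[OF \<open>i < c\<close>] trunc] rest] .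
    finally show ?thesis
      by (simp only: E_def)
  qed simp
qed

section \<open>Binomial coefficients in the ground field\<close>

text \<open>
  Modulo \<open>p\<close> one has \<open>(1 + X)\<^sup>c = (1 + X\<^sup>q)\<^sup>m\<close> with \<open>c = qm\<close>, which explains both claims. The proof is
  elementary: \<open>k (c choose k) = c (c-1 choose k-1)\<close> is divisible by \<open>q\<close>, and by Pascal's rule
  none of the numbers \<open>c-1 choose k\<close> with \<open>k < q\<close> is divisible by \<open>p\<close>.
\<close>

lemma prime_power_part_choose:
  fixes p c :: nat
  assumes "prime p" "0 < c"
  defines "q \<equiv> p ^ multiplicity p c"
  shows "0 < k \<Longrightarrow> k < q \<Longrightarrow> p dvd (c choose k)" and "\<not> p dvd (c choose q)"
proof -
  obtain m where c: "c = q * m" "\<not> p dvd m"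
    using multiplicity_decompose'[of c p] assms
    by (metis gr_implies_not0 not_prime_unit)
  have small: "p dvd (c choose k)" if "0 < k" "k < q" for k
  proof (rule ccontr)
    assume "\<not> p dvd (c choose k)"
    then have "coprime q (c choose k)"
      unfolding q_def using \<open>prime p\<close> by (simp add: prime_imp_coprime)
    moreover have "q dvd k * (c choose k)"
      using times_binomial_minus1_eq[OF \<open>0 < k\<close>, of c] c(1) by (metis dvd_mult2 dvd_triv_left)
    ultimately have "q dvd k"
      by (simp add: coprime_dvd_mult_left_iff)
    with that show False
      by (auto dest: dvd_imp_le)
  qed
  show "0 < k \<Longrightarrow> k < q \<Longrightarrow> p dvd (c choose k)"
    by (rule small)
  have pred: "\<not> p dvd ((c - 1) choose k)" if "k < q" for k
    using that
  proof (induction k)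
    case (Suc k)
    have "c choose Suc k = ((c - 1) choose k) + ((c - 1) choose Suc k)"
      using \<open>0 < c\<close> by (cases c) auto
    with Suc small[of "Suc k"] show ?case
      by (metis Suc_lessD dvd_add_left_iff zero_less_Suc)
  qed (use \<open>prime p\<close> in auto)
  have "0 < q"
    using assms by (simp add: prime_gt_0_nat)
  have "q * (c choose q) = q * (m * ((c - 1) choose (q - 1)))"
    using times_binomial_minus1_eq[OF \<open>0 < q\<close>, of c] c(1) by (metis mult.assoc)
  then have "c choose q = m * ((c - 1) choose (q - 1))"
    using \<open>0 < q\<close> by simp
  with c(2) pred[of "q - 1"] \<open>0 < q\<close> \<open>prime p\<close> show "\<not> p dvd (c choose q)"
    by (simp add: prime_dvd_mult_iff)
qed

lemma char_part_choose:
  fixes c :: nat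
  assumes "0 < c"
  defines "q \<equiv> char_part TYPE('k :: field) c"
  shows "0 < q" "q \<le> c" "of_nat (c choose q) \<noteq> (0 :: 'k)"
    and "\<And>k. 0 < k \<Longrightarrow> k < q \<Longrightarrow> of_nat (c choose k) = (0 :: 'k)"
proof -
  have "0 < q \<and> q \<le> c \<and> of_nat (c choose q) \<noteq> (0 :: 'k) \<and>
        (\<forall>k. 0 < k \<longrightarrow> k < q \<longrightarrow> of_nat (c choose k) = (0 :: 'k))"
  proof (cases "CHAR('k) = 0")
    case True
    then show ?thesis
      using assms(1) by (auto simp: q_def char_part_def of_nat_eq_0_iff_char_dvd)
  next
    case False
    then have p: "prime CHAR('k)"
      by (simp add: prime_CHAR_semidom)
    have "q = CHAR('k) ^ multiplicity CHAR('k) c"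
      using False by (simp add: q_def char_part_def)
    moreover have "q \<le> c"
      unfolding calculation using assms(1) by (intro dvd_imp_le multiplicity_dvd)
    ultimately show ?thesis
      using prime_power_part_choose[OF p assms(1)] p
      by (auto simp: of_nat_eq_0_iff_char_dvd prime_gt_0_nat)
  qed
  then show "0 < q" "q \<le> c" "of_nat (c choose q) \<noteq> (0 :: 'k)"
    and "\<And>k. 0 < k \<Longrightarrow> k < q \<Longrightarrow> of_nat (c choose k) = (0 :: 'k)"
    by blast+
qed

section \<open>Failure of cleanness\<close>

definition homogeneous :: "nat \<Rightarrow> ('n, 'k :: comm_ring_1) mps \<Rightarrow> bool" where
  "homogeneous t G \<longleftrightarrow> (\<forall>e. mps_nth G e \<noteq> 0 \<longrightarrow> expo_deg e = t)"

lemma homogeneous_power: "homogeneous t G \<Longrightarrow> homogeneous (m * t) (G ^ m)"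
proof (induction m)
  case (Suc m)
  then show ?case
    by (auto simp: homogeneous_def elim!: mps_mult_nonzeroE)
qed (auto simp: homogeneous_def mps_nth_one)

lemma mps_in_eqI:
  assumes "homogeneous t H" "H \<noteq> 0" "f - H \<in> ord_ideal (Suc t)"
  shows "mps_in f = H"
proof -
  obtain e0 where e0: "mps_nth H e0 \<noteq> 0"
    using assms(2) by (auto simp: mps_eq_iff)
  have low: "mps_nth f e = mps_nth H e" if "expo_deg e \<le> t" for e
    using assms(3) that by (force simp: ord_ideal_def)
  have H: "expo_deg e = t" if "mps_nth H e \<noteq> 0" for e
    using assms(1) that by (simp add: homogeneous_def)
  have "(LEAST m. \<exists>e. expo_deg e = m \<and> mps_nth f e \<noteq> 0) = t"
  proof (rule Least_equality)
    show "\<exists>e. expo_deg e = t \<and> mps_nth f e \<noteq> 0"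
      using e0 H low by (metis order_refl)
    show "t \<le> m" if "\<exists>e. expo_deg e = m \<and> mps_nth f e \<noteq> 0" for m
      using that H low by (metis nat_le_linear order_refl)
  qed
  then show ?thesis
    using H low by (auto simp: mps_in_def mps_eq_iff)
qed

text \<open>
  The alternatives fail for the index \<open>b\<close> as soon as \<open>f\<close> looks in lowest order like
  \<open>\<epsilon>(z + y\<^sup>bG)\<^sup>c\<close> with a form \<open>G\<close> of degree \<open>t = \<delta> - b\<sigma>\<close>. The assumption \<open>weight\<close> is this equation for
  \<open>t\<close>, multiplied by \<open>c!\<cdot>d!\<close>.
\<close>

lemma not_secondary_ord_clean:
  fixes f :: "('n, 'k :: alg_closed_field) mps fps fps"
  assumes "0 < c" and J2: "ideal_ord J2 = enat s"
    and weight: "(d + r_y) * s + fact d * expo_deg r = fact c * (fact d * t + s * b)"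
    and b: "fact c * b < d + r_y"
    and q: "q = char_part TYPE('k) c"
    and fc: "xy_coeff (fps_nth f c) 0 \<noteq> 0"
    and vanish: "\<And>i j e. c - q < i \<Longrightarrow> i < c \<Longrightarrow> j \<le> (c - i) * b \<Longrightarrow>
      fact d * expo_deg e + s * j \<le> (c - i) * (fact d * t + s * b) \<Longrightarrow> xy_coeff (fps_nth f i) (j, e) = 0"
    and G: "homogeneous t G" "G ^ q \<noteq> 0"
    and initial: "\<And>e. expo_deg e \<le> q * t \<Longrightarrow> xy_coeff (fps_nth f (c - q)) (b * q, e) =
      of_nat (c choose q) * xy_coeff (fps_nth f c) 0 * mps_nth (G ^ q) e"
  shows "\<not> secondary_ord_clean c d r r_y J2 f"
proof
  assume clean: "secondary_ord_clean c d r r_y J2 f"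
  define \<sigma> \<delta> :: real where "\<sigma> = real s / fact d" and "\<delta> = real t + real b * \<sigma>"
  define F where "F = (\<lambda>i j. fps_nth (fps_nth f i) j)"
  have \<sigma>: "ereal_of_enat (ideal_ord J2) / ereal (fact d) = ereal \<sigma>"
    by (simp add: J2 \<sigma>_def)
  have "real (d + r_y) * \<sigma> + real (expo_deg r) = fact c * \<delta>"
    using arg_cong[OF weight, of real] by (simp add: \<sigma>_def \<delta>_def field_simps)
  then have \<delta>: "(ereal (real (d + r_y)) * ereal \<sigma> + ereal (real (expo_deg r))) / ereal (fact c) = ereal \<delta>"
    by simp
  have "real b < real (d + r_y) / fact c"
  proof -
    have "real (fact c * b) < real (d + r_y)"
      using b by (rule less_imp_of_nat_less)
    then show ?thesis
      by (simp add: field_simps)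
  qed
  with clean have cases:
    "(\<exists>i j. c - q < i \<and> i < c \<and> j \<le> (c - i) * b \<and>
        ereal_of_enat (elem_ord (F i j)) = ereal (real (c - i)) * ereal \<delta> - ereal (real j) * ereal \<sigma>) \<or>
     ereal_of_enat (elem_ord (F (c - q) (b * q))) > ereal (real q) * ereal \<delta> - ereal (real (b * q)) * ereal \<sigma> \<or>
     \<not> (\<exists>G. mps_in (F (c - q) (b * q)) = mps_in (F c 0) * G ^ q)"
    unfolding secondary_ord_clean_def Let_def \<sigma> \<delta> F_def[symmetric] q[symmetric]
    by (simp add: F_def)
  define \<epsilon> \<kappa> where "\<epsilon> = xy_coeff (fps_nth f c) 0" and "\<kappa> = (of_nat (c choose q) :: 'k)"
  have "0 < q" "\<kappa> \<noteq> 0" "\<epsilon> \<noteq> 0"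
    using char_part_choose[OF \<open>0 < c\<close>, where ?'k = 'k] q fc by (auto simp: \<kappa>_def \<epsilon>_def)
  \<comment> \<open>The form of lowest degree of \<open>f\<^sub>c\<^sub>-\<^sub>q\<^sub>,\<^sub>b\<^sub>q\<close>.\<close>
  define H where "H = mps_const (\<kappa> * \<epsilon>) * G ^ q"
  have H: "homogeneous (q * t) H"
    using homogeneous_power[OF G(1), of q] by (simp add: homogeneous_def H_def)
  have "H \<noteq> 0"
    using G(2) \<open>\<kappa> \<noteq> 0\<close> \<open>\<epsilon> \<noteq> 0\<close> by (auto simp: H_def mps_eq_iff)
  have low: "mps_nth (F (c - q) (b * q)) e = mps_nth H e" if "expo_deg e \<le> q * t" for e
    using initial[OF that] by (simp add: xy_coeff_def F_def H_def \<kappa>_def \<epsilon>_def)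
  consider
    (i) i j where "c - q < i" "i < c" "j \<le> (c - i) * b"
      "ereal_of_enat (elem_ord (F i j)) = ereal (real (c - i) * \<delta> - real j * \<sigma>)"
  | (ii) "ereal_of_enat (elem_ord (F (c - q) (b * q))) > ereal (real q * \<delta> - real (b * q) * \<sigma>)"
  | (iii) "\<not> (\<exists>G. mps_in (F (c - q) (b * q)) = mps_in (F c 0) * G ^ q)"
    using cases by auto
  then show False
  proof cases
    case i
    then obtain k where k: "elem_ord (F i j) = enat k" "real k = real (c - i) * \<delta> - real j * \<sigma>"
      by (cases "elem_ord (F i j)") auto
    have "\<not> enat (Suc k) \<le> elem_ord (F i j)"
      using k(1) by simp
    then obtain e where e: "mps_nth (F i j) e \<noteq> 0" "expo_deg e \<le> k"
      unfolding elem_ord_def le_mps_ideal_ord_iff by (auto simp: ord_ideal_def not_less_eq_eq)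
    have "real (fact d * k + s * j) = real ((c - i) * (fact d * t + s * b))"
      unfolding of_nat_add of_nat_mult k(2) by (simp add: \<delta>_def \<sigma>_def field_simps)
    then have "fact d * k + s * j = (c - i) * (fact d * t + s * b)"
      by (simp only: of_nat_eq_iff)
    moreover have "fact d * expo_deg e \<le> fact d * k"
      using e(2) by simp
    ultimately have "xy_coeff (fps_nth f i) (j, e) = 0"
      by (intro vanish i(1-3)) linarith
    with e(1) show False
      by (simp add: xy_coeff_def F_def)
  next
    case ii
    have "ereal (real q * \<delta> - real (b * q) * \<sigma>) = ereal_of_enat (enat (q * t))"
      by (simp add: \<delta>_def algebra_simps)
    with ii have "enat (q * t) < elem_ord (F (c - q) (b * q))"
      by (metis ereal_of_enat_less_iff)
    then have "enat (Suc (q * t)) \<le> elem_ord (F (c - q) (b * q))"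
      by (simp add: Suc_ile_eq)
    then have "F (c - q) (b * q) \<in> ord_ideal (Suc (q * t))"
      unfolding elem_ord_def le_mps_ideal_ord_iff by simp
    then have "mps_nth (F (c - q) (b * q)) e = 0" if "expo_deg e = q * t" for e
      using that by (auto simp: ord_ideal_def)
    moreover obtain e where "mps_nth H e \<noteq> 0"
      using \<open>H \<noteq> 0\<close> by (auto simp: mps_eq_iff)
    moreover from this have "expo_deg e = q * t"
      using H by (simp add: homogeneous_def)
    ultimately show False
      using low[of e] by simp
  next
    case iii
    obtain \<rho> where \<rho>: "\<rho> ^ q = \<kappa>"
      using nth_root_exists[OF \<open>0 < q\<close>] by blast
    have "mps_in (F (c - q) (b * q)) = H"
      by (rule mps_in_eqI[OF H \<open>H \<noteq> 0\<close>])
         (use low in \<open>force simp: ord_ideal_def not_less_eq_eq[symmetric]\<close>)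
    moreover have "mps_in (F c 0) = mps_const \<epsilon>"
    proof (rule mps_in_eqI)
      show "homogeneous 0 (mps_const \<epsilon>)"
        by (simp add: homogeneous_def mps_const_def)
      show "mps_const \<epsilon> \<noteq> 0"
        using \<open>\<epsilon> \<noteq> 0\<close> by (auto simp: mps_eq_iff mps_const_def)
      show "F c 0 - mps_const \<epsilon> \<in> ord_ideal (Suc 0)"
        by (auto simp: ord_ideal_def mps_const_def \<epsilon>_def xy_coeff_def F_def Suc_le_eq intro!: gr0I split: if_splits)
    qed
    moreover have "H = mps_const \<epsilon> * (mps_const \<rho> * G) ^ q"
      by (simp add: H_def power_mult_distrib mps_const_power[symmetric] \<rho> mps_eq_iff)
    ultimately show False
      using iii by metis
  qed
qed

text \<open>
  The factorization \<open>J\<^sub>-\<^sub>1 = (\<^bold>x\<^sup>ry\<^sup>r\<^sup>y)\<cdot>I\<^sub>-\<^sub>1\<close> shifts weighted orders by the weight of the monomial. This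
  translates between estimates for the elements of \<open>J\<close> and for \<open>I\<^sub>-\<^sub>1\<close>, in both coordinate systems.
\<close>

lemma setting_val_ideal_iff:
  fixes J :: "('n, 'k :: field) mps fps fps set"
  assumes "coeff_ideal c J = (*) (xy_monom r r_y) ` I" "0 < \<xi>" "0 < \<eta>"
    and "wt \<xi> \<eta> (r_y, r) + m' = fact c * m"
  shows "(\<forall>h\<in>J. \<forall>i<c. fps_nth h i \<in> val_ideal \<xi> \<eta> ((c - i) * m)) \<longleftrightarrow> I \<subseteq> val_ideal \<xi> \<eta> m'"
  unfolding coeff_ideal_xy_subset_iff[OF assms(2,3), symmetric] assms(1) assms(4)[symmetric]
  by (auto simp: xy_monom_mult_in_val_ideal_iff)

section \<open>The clean element excludes an increase of the order\<close>

text \<open>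
  The case in which \<open>g\<close> has small weighted order. The weights \<open>\<xi>\<close>, \<open>\<eta>\<close> have the ratio
  \<open>\<eta>/\<xi> = s/d! + 1/(N\<cdot>d!)\<close>, and \<open>D/(c!\<cdot>d!)\<close> is the number \<open>\<delta>\<close>. With these weights the weight of a
  monomial is \<open>N\<close> times its weight with respect to \<open>\<sigma>\<close>, plus \<open>c!\<close> times its exponent of \<open>y\<close>. The
  factor \<open>N\<close> is so large that the first summand dominates in all comparisons that occur, as for a
  lexicographic order.
\<close>

lemma not_clean_of_small_shift:
  fixes f :: "('n, 'k :: alg_closed_field) mps fps fps"
    and g :: "('n, 'k) mps fps"
    and r :: "'n expo"
    and c d r_y s :: nat
  assumes "0 < c" "0 < s" "0 < d" and J2: "ideal_ord J2 = enat s"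
  defines "N \<equiv> d + r_y"
  defines "D \<equiv> N * s + fact d * expo_deg r"
  defines "\<xi> \<equiv> fact c * (N * fact d)" and "\<eta> \<equiv> fact c * (N * s + 1)"
  assumes g1: "xy_coeff g 0 = 0"
    and small: "g \<notin> val_ideal \<xi> \<eta> (N * D + N)"
    and fc: "xy_coeff (fps_nth f c) 0 \<noteq> 0"
    and f: "fps_nth f 0 \<in> val_ideal (fact c * fact d) (fact c * s) (c * D)"
    and shift: "\<And>i. i < c \<Longrightarrow> fps_nth (z_shift g f) i \<in> val_ideal \<xi> \<eta> ((c - i) * (N * D + N))"
  shows "\<not> secondary_ord_clean c d r r_y J2 f"
proof -
  define W where "W = (wt (fact c * fact d) (fact c * s) :: 'n xy_expo \<Rightarrow> nat)"
  have "0 < N"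
    using \<open>0 < d\<close> by (simp add: N_def)
  then have pos: "0 < \<xi>" "0 < \<eta>"
    by (simp_all add: \<xi>_def \<eta>_def)
  have wt: "wt \<xi> \<eta> \<nu> = N * W \<nu> + fact c * fst \<nu>" for \<nu>
    by (simp add: wt_def W_def \<xi>_def \<eta>_def algebra_simps)
  obtain \<nu> where \<nu>: "xy_coeff g \<nu> \<noteq> 0" "wt \<xi> \<eta> \<nu> < N * D + N"
    using small val_idealI by (metis not_le)
  obtain \<mu> where \<mu>: "xy_coeff g \<mu> \<noteq> 0" "g \<in> val_ideal \<xi> \<eta> (wt \<xi> \<eta> \<mu>)"
    "\<And>\<nu>. xy_coeff g \<nu> \<noteq> 0 \<Longrightarrow> wt \<xi> \<eta> \<nu> = wt \<xi> \<eta> \<mu> \<Longrightarrow> \<nu> \<le> \<mu>"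
    using obtain_initial_exponent[OF pos \<nu>(1)] by blast
  \<comment> \<open>\<open>\<mu>\<close> is the monomial of the initial form of \<open>g\<close> with the largest exponent of \<open>y\<close>.\<close>
  define m b t where "m = wt \<xi> \<eta> \<mu>" and "b = fst \<mu>" and "t = expo_deg (snd \<mu>)"
  have g: "g \<in> val_ideal \<xi> \<eta> m" "- g \<in> val_ideal \<xi> \<eta> m"
    using \<mu>(2) by (auto simp: m_def intro: val_ideal_uminus)
  have "m < N * D + N"
    using val_idealD[OF g(1) \<nu>(1)] \<nu>(2) by simp
  have "0 < m"
    using g1 \<mu>(1) wt_eq_0_iff[OF pos, of \<mu>] by (metis gr0I m_def)
  have shift': "fps_nth (z_shift g f) i \<in> val_ideal \<xi> \<eta> (Suc ((c - i) * m))" if "i < c" for i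
  proof (rule val_ideal_mono[OF _ shift[OF that]])
    have "Suc ((c - i) * m) \<le> (c - i) * Suc m"
      using that by simp
    also have "\<dots> \<le> (c - i) * (N * D + N)"
      using \<open>m < N * D + N\<close> by (intro mult_left_mono) auto
    finally show "Suc ((c - i) * m) \<le> (c - i) * (N * D + N)" .
  qed
  have initial: "xy_coeff (fps_nth f i) \<nu> = of_nat (c choose i) * xy_coeff (fps_nth f c * (- g) ^ (c - i)) \<nu>"
    if "i \<le> c" "wt \<xi> \<eta> \<nu> \<le> (c - i) * m" for i \<nu>
    using val_ideal_cf_eq_0[OF z_shift_initial_form[OF g(1) \<open>0 < m\<close> shift' that(1)], of \<nu>] that(2)
    by (simp add: mult.assoc)
  have lead: "xy_coeff (fps_nth f i) \<nu> = of_nat (c choose i) * (xy_coeff (fps_nth f c) 0 * xy_coeff ((- g) ^ (c - i)) \<nu>)"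
    if "i \<le> c" "wt \<xi> \<eta> \<nu> = (c - i) * m" for i \<nu>
    using initial[of i \<nu>] xy_coeff_unit_mult[OF pos, of "(- g) ^ (c - i)" \<nu>] val_ideal_power[OF g(2)] that
    by simp
  have power: "xy_coeff ((- g) ^ l) (expo_mult l \<mu>) \<noteq> 0" for l
    using xy_coeff_power_extreme[of "- g" \<xi> \<eta> \<mu> l] g(2) \<mu> by (simp add: m_def)
  \<comment> \<open>The initial form of \<open>f\<^sub>0\<close> is that of \<open>f\<^sub>c(-g)\<^sup>c\<close>, so it contains the monomial \<open>c\<mu>\<close>.\<close>
  have W_ge: "D \<le> W \<mu>"
  proof -
    have "xy_coeff (fps_nth f 0) (expo_mult c \<mu>) \<noteq> 0"
      using lead[of 0 "expo_mult c \<mu>"] power[of c] fc by (simp add: m_def)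
    from val_idealD[OF f this] show ?thesis
      using \<open>0 < c\<close> by (simp add: W_def)
  qed
  have "N * W \<mu> + fact c * b < N * D + N"
    using \<open>m < N * D + N\<close> by (simp add: m_def wt b_def)
  then have "N * W \<mu> < N * Suc D"
    by simp
  then have "W \<mu> < Suc D"
    by (simp only: mult_less_cancel1)
  then have "W \<mu> = D"
    using W_ge by simp
  then have b: "fact c * b < N"
    using \<open>N * W \<mu> + fact c * b < N * D + N\<close> by simp
  have m: "m = N * D + fact c * b"
    using \<open>W \<mu> = D\<close> by (simp add: m_def wt b_def)
  have D: "D = fact c * (fact d * t + s * b)"
    unfolding \<open>W \<mu> = D\<close>[symmetric] by (simp add: W_def wt_def t_def b_def algebra_simps)
  have wt': "wt \<xi> \<eta> (j, e) = fact c * (N * (fact d * expo_deg e + s * j) + j)" for j e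
    by (simp add: wt_def \<xi>_def \<eta>_def algebra_simps)
  \<comment> \<open>A smaller exponent of \<open>y\<close> in the initial form would differ from \<open>b\<close> by a multiple of \<open>N\<close> after multiplication by \<open>c!\<close>, but \<open>c!b < N\<close>.\<close>
  have unique: "fst \<nu> = b" if "xy_coeff g \<nu> \<noteq> 0" "wt \<xi> \<eta> \<nu> = m" for \<nu>
  proof -
    have "fst \<nu> \<le> b"
      using \<mu>(3)[OF that(1)] that(2) by (cases \<nu>; cases \<mu>) (auto simp: m_def b_def)
    then have "fact c * fst \<nu> \<le> fact c * b"
      by simp
    moreover have eq: "N * W \<nu> + fact c * fst \<nu> = N * D + fact c * b"
      using that(2) by (simp add: wt m)
    ultimately have "N * D \<le> N * W \<nu>" "N * W \<nu> < N * Suc D"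
      using b unfolding mult_Suc_right by linarith+
    then have "D \<le> W \<nu>" "W \<nu> < Suc D"
      using \<open>0 < N\<close> by (simp_all only: mult_le_cancel1 mult_less_cancel1)
    then have "W \<nu> = D"
      by simp
    with eq show ?thesis
      by simp
  qed
  \<comment> \<open>By uniqueness of the exponent of \<open>y\<close>, the initial form of \<open>-g\<close> is \<open>y\<^sup>bG\<close>.\<close>
  define G :: "('n, 'k) mps" where "G = Abs_mps (\<lambda>e. if expo_deg e = t then - xy_coeff g (b, e) else 0)"
  define h where "h = fps_X ^ b * fps_const G"
  have xy_coeff_h: "xy_coeff h (j, e) = (if j = b then mps_nth G e else 0)" for j e
    by (simp add: h_def xy_coeff_def fps_X_power_mult_nth)
  have wt_b: "wt \<xi> \<eta> (b, e) = m \<longleftrightarrow> expo_deg e = t" for e :: "'n expo"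
    using \<open>0 < N\<close> unfolding m D wt' by (simp add: algebra_simps)
  have h: "h \<in> val_ideal \<xi> \<eta> m"
  proof (rule val_idealI)
    fix \<nu>
    assume "xy_coeff h \<nu> \<noteq> 0"
    then show "m \<le> wt \<xi> \<eta> \<nu>"
      using wt_b[of "snd \<nu>"] by (cases \<nu>) (auto simp: xy_coeff_h G_def split: if_splits)
  qed
  have gh: "- g - h \<in> val_ideal \<xi> \<eta> (Suc m)"
  proof (rule val_idealI, rule ccontr)
    fix \<nu>
    assume nz: "xy_coeff (- g - h) \<nu> \<noteq> 0" and "\<not> Suc m \<le> wt \<xi> \<eta> \<nu>"
    with val_idealD[OF val_ideal_diff[OF g(2) h], of \<nu>] have "wt \<xi> \<eta> \<nu> = m"
      by simp
    with nz unique[of \<nu>] wt_b show False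
      by (cases \<nu>) (auto simp: xy_coeff_h G_def split: if_splits)
  qed
  define q where "q = char_part TYPE('k) c"
  note q = char_part_choose[OF \<open>0 < c\<close>, where ?'k = 'k, folded q_def]
  have hq: "xy_coeff ((- g) ^ q) (b * q, e) = mps_nth (G ^ q) e" if "expo_deg e = q * t" for e
  proof -
    have "wt \<xi> \<eta> (b * q, e) = q * m"
      unfolding m D wt' that by (simp add: algebra_simps)
    then have "xy_coeff ((- g) ^ q) (b * q, e) = xy_coeff (h ^ q) (b * q, e)"
      using val_ideal_cf_eq_0[OF val_ideal_power_cong[OF gh g(2) h, of q], of "(b * q, e)"] by simp
    also have "h ^ q = fps_X ^ (b * q) * fps_const (G ^ q)"
      by (simp add: h_def power_mult_distrib power_mult fps_const_power)
    finally show ?thesis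
      by (simp add: xy_coeff_def fps_X_power_mult_nth)
  qed
  show ?thesis
  proof (rule not_secondary_ord_clean[where t = t and b = b and q = q and G = G])
    show "0 < c" "ideal_ord J2 = enat s" "q = char_part TYPE('k) c" "xy_coeff (fps_nth f c) 0 \<noteq> 0"
      by (simp_all add: q_def fc J2 \<open>0 < c\<close>)
    show "(d + r_y) * s + fact d * expo_deg r = fact c * (fact d * t + s * b)"
      using D by (simp add: D_def N_def)
    show "fact c * b < d + r_y"
      using b by (simp add: N_def)
    show "homogeneous t G"
      by (simp add: homogeneous_def G_def)
    show "xy_coeff (fps_nth f i) (j, e) = 0"
      if "c - q < i" "i < c" "j \<le> (c - i) * b"
        "fact d * expo_deg e + s * j \<le> (c - i) * (fact d * t + s * b)" for i j e
    proof -
      have "c choose i = c choose (c - i)"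
        using binomial_symmetric[of i c] that by simp
      then have "of_nat (c choose i) = (0 :: 'k)"
        using q(4)[of "c - i"] that by simp
      moreover have "wt \<xi> \<eta> (j, e) \<le> (c - i) * m"
      proof -
        have "wt \<xi> \<eta> (j, e) \<le> fact c * (N * ((c - i) * (fact d * t + s * b)) + (c - i) * b)"
          unfolding wt' using that(3,4) by (intro mult_left_mono add_mono) auto
        then show ?thesis
          unfolding m D by (simp add: algebra_simps)
      qed
      ultimately show ?thesis
        using initial[of i "(j, e)"] that by simp
    qed
    show "xy_coeff (fps_nth f (c - q)) (b * q, e) =
        of_nat (c choose q) * xy_coeff (fps_nth f c) 0 * mps_nth (G ^ q) e"
      if e: "expo_deg e \<le> q * t" for e
    proof (cases "expo_deg e = q * t")
      case True
      have "wt \<xi> \<eta> (b * q, e) = q * m"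
        unfolding m D wt' True by (simp add: algebra_simps)
      with True q(2) show ?thesis
        using lead[of "c - q" "(b * q, e)"] hq[of e] binomial_symmetric[of q c] by simp
    next
      case False
      have "homogeneous (q * t) (G ^ q)"
        using \<open>homogeneous t G\<close> by (rule homogeneous_power)
      with False have "mps_nth (G ^ q) e = 0"
        by (auto simp: homogeneous_def)
      have "fact d * expo_deg e < fact d * (q * t)"
        using e False by simp
      then have "N * (fact d * expo_deg e) < N * (fact d * (q * t))"
        using \<open>0 < N\<close> by simp
      then have "fact c * (N * (fact d * expo_deg e) + (N * (s * (b * q)) + b * q)) <
          fact c * (N * (fact d * (q * t)) + (N * (s * (b * q)) + b * q))"
        by simp
      then have "wt \<xi> \<eta> (b * q, e) < q * m"
        unfolding m D wt' by (simp only: algebra_simps)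
      moreover have "fps_nth f c * (- g) ^ q \<in> val_ideal \<xi> \<eta> (q * m)"
        by (intro val_ideal_mult_left val_ideal_power g(2))
      ultimately show ?thesis
        using initial[of "c - q" "(b * q, e)"] q(2) \<open>mps_nth (G ^ q) e = 0\<close>
        by (simp add: val_ideal_cf_eq_0)
    qed
    have "mps_nth (G ^ q) (snd (expo_mult q \<mu>)) \<noteq> 0"
      using hq[of "snd (expo_mult q \<mu>)"] power[of q]
      by (metis b_def expo_deg_expo_mult fst_expo_mult mult.commute prod.collapse t_def)
    then show "G ^ q \<noteq> 0"
      by auto
  qed
qed

theorem proposition5p2p5:
  fixes J :: "('n, 'k :: alg_closed_field) mps fps fps set"
    and I I' :: "('n, 'k) mps fps set"
    and g :: "('n, 'k) mps fps"
    and f :: "('n, 'k) mps fps fps"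
    and r :: "'n expo"
    and c d r_y :: nat
  assumes "c > 0"
    and "is_ideal J" and "ideal_ord J = enat c"
    and "is_ideal I" and "ideal_ord I = enat d"
    and "coeff_ideal c J = (*) (xy_monom r r_y) ` I"
    and "elem_ord g \<ge> 1"
    and "is_ideal I'" and "ideal_ord I' = enat d"
    and "coeff_ideal c (z_shift g ` J) = (*) (xy_monom r r_y) ` I'"
    and "f \<in> J" and "secondary_ord_clean c d r r_y (coeff_ideal d I) f"
  shows "ideal_ord (coeff_ideal d I') \<le> ideal_ord (coeff_ideal d I)"
proof (rule ccontr)
  assume "\<not> ideal_ord (coeff_ideal d I') \<le> ideal_ord (coeff_ideal d I)"
  then have less: "ideal_ord (coeff_ideal d I) < ideal_ord (coeff_ideal d I')"
    by simp
  then obtain s where s: "ideal_ord (coeff_ideal d I) = enat s"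
    by (cases "ideal_ord (coeff_ideal d I)") auto
  have I: "(d - j) * s \<le> fact d * expo_deg e" if "a \<in> I" "xy_coeff a (j, e) \<noteq> 0" for a j e
    using coeff_ideal_mps_subset_iff[of s d I] that by (cases "j < d") (auto simp: s)
  have I': "(d - j) * Suc s \<le> fact d * expo_deg e" if "a \<in> I'" "xy_coeff a (j, e) \<noteq> 0" for a j e
    using coeff_ideal_mps_subset_iff[of "Suc s" d I'] less that
    by (cases "j < d") (auto simp: s Suc_ile_eq)
  have not_Suc: "\<not> enat (Suc s) \<le> ideal_ord (coeff_ideal d I)"
    by (simp add: s)
  then have "0 < d"
    unfolding coeff_ideal_mps_subset_iff by auto
  \<comment> \<open>\<open>\<sigma>\<close> must be a positive weight. This holds because elements of \<open>I\<^sub>-\<^sub>1\<close> have order at least \<open>d\<close>.\<close>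
  have "0 < s"
  proof -
    have "I \<subseteq> val_ideal 1 1 d"
      using le_ideal_ord_iff[of d I] ideal_pow_max_ideal_xy[of d] assms(5) by auto
    then have "enat 1 \<le> ideal_ord (coeff_ideal d I)"
      unfolding coeff_ideal_mps_subset_iff
    proof (intro ballI allI impI)
      fix a j e
      assume "I \<subseteq> val_ideal 1 1 d" "a \<in> I" "xy_coeff a (j, e) \<noteq> 0"
      then have "d \<le> expo_deg e + j"
        using val_idealD[of a 1 1 d "(j, e)"] by (auto simp: wt_def)
      moreover have "expo_deg e \<le> fact d * expo_deg e"
        by (simp add: fact_ge_1)
      ultimately show "(d - j) * 1 \<le> fact d * expo_deg e"
        by linarith
    qed
    then show ?thesis
      by (simp add: s)
  qed
  define N D \<xi> \<eta> where "N = d + r_y" and "D = N * s + fact d * expo_deg r"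
    and "\<xi> = fact c * (N * fact d)" and "\<eta> = fact c * (N * s + 1)"
  have "0 < N" "0 < \<xi>" "0 < \<eta>"
    using \<open>0 < d\<close> by (simp_all add: N_def \<xi>_def \<eta>_def)
  \<comment> \<open>Weights are scaled by \<open>c!\<cdot>N\<cdot>d!\<close>: the bounds below are \<open>d\<sigma>'\<close> and \<open>\<delta>'\<close> for \<open>\<sigma>' = \<sigma> + 1/(N\<cdot>d!)\<close>.\<close>
  note pert = setting_val_ideal_iff[OF _ \<open>0 < \<xi>\<close> \<open>0 < \<eta>\<close>, of c _ r r_y _ "fact c * (d * (N * s + 1))" "N * D + N"]
  have wt_r: "wt \<xi> \<eta> (r_y, r) + fact c * (d * (N * s + 1)) = fact c * (N * D + N)"
    by (simp add: wt_def \<xi>_def \<eta>_def D_def) (simp add: N_def algebra_simps)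
  \<comment> \<open>The estimates for the coefficients of all elements of \<open>J\<close>, with respect to \<open>\<sigma>\<close>.\<close>
  have orig: "\<forall>h\<in>J. \<forall>i<c. fps_nth h i \<in> val_ideal (fact c * fact d) (fact c * s) ((c - i) * D)"
  proof (subst setting_val_ideal_iff[OF assms(6)])
    show "wt (fact c * fact d) (fact c * s) (r_y, r) + fact c * (d * s) = fact c * D"
      by (simp add: wt_def D_def N_def algebra_simps)
    show "I \<subseteq> val_ideal (fact c * fact d) (fact c * s) (fact c * (d * s))"
    proof (intro subsetI val_idealI)
      fix a \<mu>
      assume "a \<in> I" "xy_coeff a \<mu> \<noteq> 0"
      then have "(d - fst \<mu>) * s \<le> fact d * expo_deg (snd \<mu>)"
        by (intro I) auto
      moreover have "d * s \<le> (d - fst \<mu>) * s + fst \<mu> * s"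
        unfolding add_mult_distrib[symmetric] by (rule mult_right_mono) auto
      ultimately have "d * s \<le> fact d * expo_deg (snd \<mu>) + s * fst \<mu>"
        by (simp add: mult.commute)
      then have "fact c * (d * s) \<le> fact c * (fact d * expo_deg (snd \<mu>) + s * fst \<mu>)"
        by simp
      then show "fact c * (d * s) \<le> wt (fact c * fact d) (fact c * s) \<mu>"
        by (simp add: wt_def algebra_simps)
    qed
  qed (use \<open>0 < s\<close> in simp_all)
  \<comment> \<open>The estimates with respect to \<open>\<sigma>'\<close> in the new coordinates. They hold because the order of the new second coefficient ideal is at least \<open>s + 1\<close>.\<close>
  have shifted: "\<forall>h\<in>z_shift g ` J. \<forall>i<c. fps_nth h i \<in> val_ideal \<xi> \<eta> ((c - i) * (N * D + N))"
  proof (subst pert[OF assms(10) wt_r], intro subsetI val_idealI)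
    fix a \<mu>
    assume "a \<in> I'" "xy_coeff a \<mu> \<noteq> 0"
    then have *: "(d - fst \<mu>) * Suc s \<le> fact d * expo_deg (snd \<mu>)"
      by (intro I') auto
    have "N * s + 1 \<le> N * Suc s"
      using \<open>0 < N\<close> by simp
    then have "(d - fst \<mu>) * (N * s + 1) \<le> N * ((d - fst \<mu>) * Suc s)"
      by (subst mult.left_commute) (rule mult_le_mono2)
    also have "\<dots> \<le> N * (fact d * expo_deg (snd \<mu>))"
      using * by simp
    finally have "(d - fst \<mu>) * (N * s + 1) + fst \<mu> * (N * s + 1) \<le>
        N * (fact d * expo_deg (snd \<mu>)) + fst \<mu> * (N * s + 1)"
      by simp
    moreover have "d * (N * s + 1) \<le> (d - fst \<mu>) * (N * s + 1) + fst \<mu> * (N * s + 1)"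
      unfolding add_mult_distrib[symmetric] by (rule mult_right_mono) auto
    ultimately have "fact c * (d * (N * s + 1)) \<le> fact c * (N * (fact d * expo_deg (snd \<mu>)) + fst \<mu> * (N * s + 1))"
      by (intro mult_left_mono) auto
    then show "fact c * (d * (N * s + 1)) \<le> wt \<xi> \<eta> \<mu>"
      by (simp add: wt_def \<xi>_def \<eta>_def algebra_simps)
  qed
  show False
  proof (cases "g \<in> val_ideal \<xi> \<eta> (N * D + N)")
    case True
    have "\<forall>h\<in>J. \<forall>i<c. fps_nth h i \<in> val_ideal \<xi> \<eta> ((c - i) * (N * D + N))"
      using z_shift_val_ideal_back[OF True] shifted by blast
    \<comment> \<open>The estimates for \<open>\<sigma>' > \<sigma>\<close> also hold in the original coordinates, so the order \<open>s\<close> was not the maximal one.\<close>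
    then have sub: "I \<subseteq> val_ideal \<xi> \<eta> (fact c * (d * (N * s + 1)))"
      unfolding pert[OF assms(6) wt_r] .
    have "enat (Suc s) \<le> ideal_ord (coeff_ideal d I)"
      unfolding coeff_ideal_mps_subset_iff
    proof (intro ballI allI impI)
      fix a j e
      assume "a \<in> I" "j < d" "xy_coeff a (j, e) \<noteq> 0"
      with sub have "fact c * (d * (N * s + 1)) \<le> wt \<xi> \<eta> (j, e)"
        by (intro val_idealD[of a]) auto
      also have "\<dots> = fact c * (N * (fact d * expo_deg e) + j * (N * s + 1))"
        by (simp add: wt_def \<xi>_def \<eta>_def algebra_simps)
      finally have "d * (N * s + 1) \<le> N * (fact d * expo_deg e) + j * (N * s + 1)"
        by (subst (asm) mult_le_cancel1) simp
      then have "(d - j) * (N * s + 1) \<le> N * (fact d * expo_deg e)"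
        by (simp only: diff_mult_distrib le_diff_conv)
      also have "\<dots> = (d - j) * (N * (fact d div (d - j) * expo_deg e))"
        by (subst mult_div_fact[OF \<open>j < d\<close>, symmetric]) (simp only: ac_simps)
      finally have "N * s + 1 \<le> N * (fact d div (d - j) * expo_deg e)"
        using \<open>j < d\<close> by (subst (asm) mult_le_cancel1) simp
      then have "N * s < N * (fact d div (d - j) * expo_deg e)"
        by linarith
      then have "Suc s \<le> fact d div (d - j) * expo_deg e"
        by (simp only: mult_less_cancel1 Suc_le_eq)
      then have "(d - j) * Suc s \<le> (d - j) * (fact d div (d - j) * expo_deg e)"
        by (rule mult_le_mono2)
      also have "\<dots> = fact d * expo_deg e"
        by (subst (2) mult_div_fact[OF \<open>j < d\<close>, symmetric]) (simp only: ac_simps)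
      finally show "(d - j) * Suc s \<le> fact d * expo_deg e" .
    qed
    with not_Suc show False ..
  next
    case False
    have "g \<in> val_ideal 1 1 1"
      using assms(7) ideal_pow_max_ideal_xy[of 1]
      by (auto simp: elem_ord_def le_ideal_ord_iff one_enat_def)
    then have "xy_coeff g 0 = 0"
      by (rule val_ideal_cf_eq_0) simp
    have "xy_coeff (fps_nth f c) 0 \<noteq> 0"
    proof -
      obtain u :: "'k fps" where u: "u dvd 1"
        "Abs_fps (\<lambda>i. mps_nth (fps_nth (fps_nth f i) 0) 0) = fps_X ^ c * u"
        using assms(12) by (auto simp: secondary_ord_clean_def z_regular_def)
      from arg_cong[OF u(2), of "\<lambda>h. fps_nth h c"] have "xy_coeff (fps_nth f c) 0 = fps_nth u 0"
        by (simp add: xy_coeff_def fps_X_power_mult_nth)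
      then show ?thesis
        using u(1) by simp
    qed
    have "\<not> secondary_ord_clean c d r r_y (coeff_ideal d I) f"
    proof (rule not_clean_of_small_shift[OF assms(1) \<open>0 < s\<close> \<open>0 < d\<close> s \<open>xy_coeff g 0 = 0\<close> _ \<open>xy_coeff (fps_nth f c) 0 \<noteq> 0\<close>])
      show "g \<notin> val_ideal (fact c * ((d + r_y) * fact d)) (fact c * ((d + r_y) * s + 1))
          ((d + r_y) * ((d + r_y) * s + fact d * expo_deg r) + (d + r_y))"
        using False by (simp add: \<xi>_def \<eta>_def D_def N_def)
      show "fps_nth f 0 \<in> val_ideal (fact c * fact d) (fact c * s) (c * ((d + r_y) * s + fact d * expo_deg r))"
        using orig[rule_format, OF assms(11,1)] by (simp add: D_def N_def)
      show "fps_nth (z_shift g f) i \<in> val_ideal (fact c * ((d + r_y) * fact d)) (fact c * ((d + r_y) * s + 1))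
          ((c - i) * ((d + r_y) * ((d + r_y) * s + fact d * expo_deg r) + (d + r_y)))" if "i < c" for i
        using shifted that assms(11) by (simp add: \<xi>_def \<eta>_def D_def N_def)
    qed
    with assms(12) show False by blast
  qed
qed

end
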